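(* Let $q$ be a prime power, $m\ge 2$, and let $A_1, \dotsc, A_m \in \mathrm{SL}(2,q)$ be such that $\langle A_1, A_2 \rangle$ is absolutely irreducible. Let $t = (\mathrm{tr}(A_1), \mathrm{tr}(A_2), \mathrm{tr}(A_1A_2))$, and let $a_i \in \mathrm{PSL}(2,q)$ be the image of $A_i$. Then $\langle a_1, \dotsc, a_m \rangle$ is isomorphic to the alternating group $A_4$ if and only if one of the following conditions is satisfied. (1) $t = (0,0,0)$ and $\theta_B(A_i) \in \Theta_4$ for all $3 \leq i \leq m$, where $B = (A_1, A_2)$, and at least one $\theta_B(A_i)$ is of the form $(\pm 1, \pm 1, \pm 1, \pm 1)$. (2) $t = (0,\pm 1,\pm 1)$ and $\theta_B(A_i) \in \Theta_4$ for all $3 \leq i \leq m$, where $B = (A_1, A_2^{-1}A_1A_2)$. (3) $t = (\pm 1, 0, \pm 1)$ and $\theta_B(A_i) \in \Theta_4$ for all $3 \leq i \leq m$, where $B = (A_2, A_1^{-1}A_2A_1)$. (4) $t = (\pm 1, \pm 1, 0)$ and $\theta_B(A_i) \in \Theta_4$ for all $3 \leq i \leq m$, where $B = (A_1A_2, A_2A_1)$. (5) $t = (\pm 1, \pm 1, \pm 1)$ with an even number of $-1$'s, and $\theta_B(A_i) \in \Theta_4$ for all $3 \leq i \leq m$, where $B = (A_1A_2^{-1}, A_2^{-1}A_1)$. All $\pm$ signs are independent of each other, except for the parity restriction in (5).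
   Context: For $B = (B_1, B_2) \in \mathrm{SL}(2,q)^2$ and $X \in \mathrm{SL}(2,q)$, $$\theta_B(X) := (\mathrm{tr}(X), \mathrm{tr}(B_1X), \mathrm{tr}(B_2X), \mathrm{tr}(B_1B_2X)) \in \mathbb F_q^4 .$$ $\Theta_4\subset\mathbb F_q^4$ is the set $\{(\pm 2, 0, 0, 0), (0, \pm 2, 0, 0), (0, 0, \pm 2, 0), (0, 0, 0, \pm 2), (\pm 1, \pm 1, \pm 1, \pm 1)\}$ with all sign choices independent. *)

theory Defs
  imports
    "HOL-Analysis.Determinants"
    "HOL-Algebra.Generated_Groups"
    "HOL-Algebra.Sym_Groups"
    "HOL-Algebra.Algebraic_Closure_Type"
begin

definition SL2 :: "('a::field^2^2) monoid" where
  "SL2 = \<lparr>carrier = {A. det A = 1}, mult = (**), one = mat 1\<rparr>"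

lemma SL2_simps [simp]:
  "carrier SL2 = {A :: 'a::field^2^2. det A = 1}"
  "mult SL2 = ((**) :: 'a^2^2 \<Rightarrow> _)"
  "one SL2 = (mat 1 :: 'a^2^2)"
  by (simp_all add: SL2_def)

lemma group_SL2: "group (SL2 :: ('a::field^2^2) monoid)"
proof (rule groupI)
  fix A :: "'a^2^2"
  assume "A \<in> carrier SL2"
  hence A: "det A = 1" by simp
  then obtain B where B: "A ** B = mat 1" "B ** A = mat 1"
    using invertible_det_nz[of A] by (auto simp: invertible_def)
  have "det (B ** A) = 1" using B by simp
  hence "det B = 1" using A by (simp add: det_mul)
  thus "\<exists>B\<in>carrier SL2. B \<otimes>\<^bsub>SL2\<^esub> A = \<one>\<^bsub>SL2\<^esub>" using B by auto
qed (simp_all add: det_mul matrix_mul_assoc)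

(* Over a field the centre of SL(2) consists of the scalar matrices c I with c^2 = 1, i.e. c = 1 or
   c = -1; it is trivial in characteristic 2. *)
definition SL2_centre :: "('a::field^2^2) set" where
  "SL2_centre = {mat 1, - mat 1}"

lemma normal_SL2_centre: "(SL2_centre :: ('a::field^2^2) set) \<lhd> SL2"
proof -
  interpret group "SL2 :: ('a^2^2) monoid" by (rule group_SL2)
  have neg: "A ** (- B) = - (A ** B)" "(- A) ** B = - (A ** B)" for A B :: "'a^2^2"
    by (simp_all add: matrix_matrix_mult_def vec_eq_iff sum_negf)
  have det_neg: "det (- mat 1 :: 'a^2^2) = 1"
    by (simp add: det_2 mat_def)
  have "inv\<^bsub>SL2\<^esub> (- mat 1 :: 'a^2^2) = - mat 1"
    by (rule inv_equality) (simp_all add: neg det_neg)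
  moreover have "inv\<^bsub>SL2\<^esub> (mat 1 :: 'a^2^2) = mat 1"
    by (rule inv_equality) simp_all
  ultimately have "subgroup (SL2_centre :: ('a^2^2) set) SL2"
    by unfold_locales (auto simp: SL2_centre_def neg det_neg)
  moreover have "x ** h ** inv\<^bsub>SL2\<^esub> x \<in> SL2_centre"
    if "x \<in> carrier SL2" "h \<in> SL2_centre" for x h :: "'a^2^2"
    using that r_inv[OF that(1)] by (auto simp: SL2_centre_def neg)
  ultimately show ?thesis
    by (simp add: normal_inv_iff)
qed

definition PSL2 :: "('a::field^2^2) set monoid" where
  "PSL2 = SL2 Mod SL2_centre"

definition to_PSL2 :: "'a::field^2^2 \<Rightarrow> ('a^2^2) set" where
  "to_PSL2 A = SL2_centre #>\<^bsub>SL2\<^esub> A"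

(* Irreducibility concerns the natural module of column vectors; absolute irreducibility is
   irreducibility after extending scalars to the algebraic closure. *)
definition irreducible_matrices :: "('a::field^'n^'n) set \<Rightarrow> bool" where
  "irreducible_matrices H \<longleftrightarrow>
     (\<forall>W. vec.subspace W \<and> (\<forall>A\<in>H. \<forall>v\<in>W. A *v v \<in> W) \<longrightarrow> W = {0} \<or> W = UNIV)"

definition absolutely_irreducible :: "('a::field^'n^'n) set \<Rightarrow> bool" where
  "absolutely_irreducible H \<longleftrightarrow> irreducible_matrices (map_matrix to_ac ` H)"

definition theta :: "('a::field^2^2) \<times> ('a^2^2) \<Rightarrow> 'a^2^2 \<Rightarrow> 'a \<times> 'a \<times> 'a \<times> 'a" where
  "theta B A = (case B of (B1, B2) \<Rightarrow>
     (trace A, trace (B1 ** A), trace (B2 ** A), trace (B1 ** B2 ** A)))"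

definition pm :: "'a::field \<Rightarrow> 'a set" where
  "pm x = {x, - x}"

definition Theta4_ones :: "('a::field \<times> 'a \<times> 'a \<times> 'a) set" where
  "Theta4_ones = pm 1 \<times> pm 1 \<times> pm 1 \<times> pm 1"

definition Theta4 :: "('a::field \<times> 'a \<times> 'a \<times> 'a) set" where
  "Theta4 = pm 2 \<times> {0} \<times> {0} \<times> {0} \<union> {0} \<times> pm 2 \<times> {0} \<times> {0} \<union>
            {0} \<times> {0} \<times> pm 2 \<times> {0} \<union> {0} \<times> {0} \<times> {0} \<times> pm 2 \<union> Theta4_ones"

end

(*
  Elements of PSL(2,q) of order 2 and 3 are recognised by their traces: 0 and +-1 respectively.
  If B1, B2 in SL(2,q) are such that B1, B2 and B1 B2 have trace 0, they generate a quaternion group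
  when q is odd, and I, B1, B2, B1 B2 is an orthogonal basis for the trace form; so theta_B determines
  a matrix, and theta_B takes values in Theta_4 exactly on the binary tetrahedral group containing
  this quaternion group. The image of that group in PSL(2,q) is A_4, presented by b1, b2 and an
  element c of order 3 permuting b1, b2, b1 b2 cyclically.

  If the a_i generate a copy of A_4, then a_1, a_2 either generate its Klein subgroup V, which is (1),
  or one of a_1, a_2, a_1 a_2, a_1 a_2^-1 lies in V and a_1, a_2 do not both; this gives (2)-(5), with
  B consisting of that element and a conjugate. Cases (3), (4), (5) are case (2) for the pairs
  (A_2, A_1), (A_1 A_2, A_2^-1) and (A_1 A_2^-1, A_2). Absolute irreducibility only enters through
  det (A_1 A_2 - A_2 A_1) /= 0, which excludes cyclic <a_1, a_2> and, since this determinant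
  is 4 or 2 under the trace conditions, also characteristic 2.
*)
theory Submission
  imports Defs
begin

no_notation fps_nth (infixl "$" 75)

section \<open>Two-by-two matrices\<close>

lemma mat2_eq_iff:
  fixes P Q :: "'a^2^2"
  shows "P = Q \<longleftrightarrow> P$1$1 = Q$1$1 \<and> P$1$2 = Q$1$2 \<and> P$2$1 = Q$2$1 \<and> P$2$2 = Q$2$2"
  by (auto simp: vec_eq_iff forall_2)

lemma mat2_mult_nth:
  fixes P Q :: "'a::semiring_1^2^2"
  shows "(P ** Q)$i$j = P$i$1 * Q$1$j + P$i$2 * Q$2$j"
  by (simp add: matrix_matrix_mult_def sum_2)

lemma trace_2: "trace (P :: 'a::semiring_1^2^2) = P$1$1 + P$2$2"
  by (simp add: trace_def sum_2)

lemma mat2_nth: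
  "(mat c :: 'a::zero^2^2)$1$1 = c" "(mat c :: 'a^2^2)$1$2 = 0"
  "(mat c :: 'a^2^2)$2$1 = 0" "(mat c :: 'a^2^2)$2$2 = c"
  by (simp_all add: mat_def)

lemmas mat2_simps = mat2_eq_iff mat2_mult_nth trace_2 mat2_nth det_2

lemma mat_mult_uminus [simp]:
  fixes P :: "'a::ring_1^'n^'m" and Q :: "'a^'k^'n"
  shows "P ** (- Q) = - (P ** Q)" "(- P) ** Q = - (P ** Q)"
  by (simp_all add: matrix_matrix_mult_def vec_eq_iff sum_negf)

lemma trace_uminus [simp]: "trace (- P :: 'a::ring_1^'n^'n) = - trace P"
  by (simp add: trace_def sum_negf)

lemma mat2_cayley_hamilton:
  "P ** P = mat (trace P) ** P - mat (det (P :: 'a::comm_ring_1^2^2))"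
  by (simp add: mat2_simps algebra_simps)

text \<open>Cayley-Hamilton for \<open>P\<close>, multiplied by \<open>Q\<close>, under the trace.
  Repeated factors in the traces below are removed with it.\<close>

lemma trace_square_mult:
  fixes P Q :: "'a::comm_ring_1^2^2"
  shows "trace (P ** P ** Q) = trace P * trace (P ** Q) - det P * trace Q"
  by (simp add: mat2_simps algebra_simps)

text \<open>\<open>mat (trace P) - P\<close> is the adjugate of a 2x2 matrix. Since
  \<open>matrix_inv\<close> is defined by choice, its two-sided inverse property comes from the
  existence of some inverse.\<close>

lemma matrix_inv_SL2:
  fixes P :: "'a::field^2^2"
  assumes "det P = 1"
  shows "matrix_inv P ** P = mat 1" "P ** matrix_inv P = mat 1"
    and "det (matrix_inv P) = 1" "matrix_inv P = mat (trace P) - P"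
proof -
  have "invertible P" using assms by (simp add: invertible_det_nz)
  thus 1: "matrix_inv P ** P = mat 1" and "P ** matrix_inv P = mat 1"
    using someI_ex[of "\<lambda>Q. P ** Q = mat 1 \<and> Q ** P = mat 1"]
    unfolding invertible_def matrix_inv_def by auto
  have "det (matrix_inv P ** P) = 1" by (simp add: 1)
  thus "det (matrix_inv P) = 1" using assms by (simp add: det_mul)
  have "(mat (trace P) - P) ** P = mat 1"
    using assms by (simp add: mat2_simps algebra_simps)
  hence "(mat (trace P) - P) ** P ** matrix_inv P = matrix_inv P" by simp
  thus "matrix_inv P = mat (trace P) - P"
    by (simp add: matrix_mul_assoc[symmetric] \<open>P ** matrix_inv P = mat 1\<close>)
qed

text \<open>Fricke's trace identity, immediate from the adjugate formula for the inverse.\<close>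

lemma trace_matrix_inv_mult:
  fixes P Q :: "'a::field^2^2"
  assumes "det P = 1"
  shows "trace (matrix_inv P ** Q) = trace P * trace Q - trace (P ** Q)"
  unfolding matrix_inv_SL2(4)[OF assms] by (simp add: mat2_simps algebra_simps)

lemma trace_matrix_inv: "det P = 1 \<Longrightarrow> trace (matrix_inv P) = trace (P :: 'a::field^2^2)"
  by (subst matrix_inv_SL2(4)) (simp_all add: mat2_simps)

lemma matrix_inv_matrix_inv: "det P = 1 \<Longrightarrow> matrix_inv (matrix_inv P) = (P :: 'a::field^2^2)"
  by (subst matrix_inv_SL2(4), simp add: matrix_inv_SL2(3),
      subst matrix_inv_SL2(4), simp, simp add: trace_matrix_inv)

text \<open>In SL(2), with x, y, z the traces of \<open>P\<close>, \<open>Q\<close>,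
  \<open>P ** Q\<close>, this is the Fricke polynomial 4 - x^2 - y^2 - z^2 + xyz, or 2 minus the
  trace of the group commutator.\<close>

lemma det_commutator:
  fixes P Q :: "'a::comm_ring_1^2^2"
  shows "det (P ** Q - Q ** P) =
    4 * det P * det Q - trace P * trace P * det Q - trace Q * trace Q * det P
      - trace (P ** Q) * trace (P ** Q) + trace P * trace Q * trace (P ** Q)"
  by (simp add: mat2_simps algebra_simps)

text \<open>The bilinear part of Cayley-Hamilton for \<open>P + Q\<close>.\<close>

lemma mat2_polarized_cayley_hamilton:
  fixes P Q :: "'a::comm_ring_1^2^2"
  shows "P ** Q + Q ** P =
    mat (trace P) ** Q + mat (trace Q) ** P + mat (trace (P ** Q) - trace P * trace Q)"
  by (simp add: mat2_simps algebra_simps)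

lemma trace_zero_anticommute:
  fixes P Q :: "'a::comm_ring_1^2^2"
  assumes "trace P = 0" "trace Q = 0" "trace (P ** Q) = 0"
  shows "Q ** P = - (P ** Q)"
proof -
  have "P ** Q + Q ** P = 0"
    using mat2_polarized_cayley_hamilton[of P Q] assms by simp
  thus ?thesis by (simp add: eq_neg_iff_add_eq_0 add.commute)
qed

section \<open>Absolute irreducibility\<close>

text \<open>A form of Schur's lemma: the kernel of \<open>M\<close> is invariant, and it is nonzero
  because \<open>M\<close> is singular. Asking only for some \<open>N\<close>, not for
  \<open>M\<close> to commute with \<open>P\<close>, makes the lemma applicable to a
  commutator.\<close>

lemma invariant_proper_kernel:
  fixes M :: "'a::field^'n^'n" and H :: "('a^'n^'n) set"
  assumes "irreducible_matrices H" "\<And>P. P \<in> H \<Longrightarrow> \<exists>N. M ** P = N ** M" "det M = 0"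
  shows "M = 0"
proof -
  let ?W = "{v. M *v v = 0}"
  have "vec.subspace ?W"
    unfolding vec.subspace_def by (simp add: vec.add vec.scale)
  moreover have "P *v v \<in> ?W" if "P \<in> H" "v \<in> ?W" for P v
  proof -
    obtain N where "M ** P = N ** M" using assms(2) \<open>P \<in> H\<close> by blast
    hence "M *v (P *v v) = N *v (M *v v)" by (simp add: matrix_vector_mul_assoc)
    thus ?thesis using that by simp
  qed
  ultimately have "?W = {0} \<or> ?W = UNIV"
    using assms(1) unfolding irreducible_matrices_def by blast
  moreover have "?W \<noteq> {0}"
    using assms(3) invertible_det_nz[of M] matrix_left_invertible_ker[of M]
      invertible_left_inverse[of M] by blast
  ultimately have "M *v v = 0" for v by blast
  thus ?thesis by (simp add: matrix_eq)
qed

lemma exists_eigenvalue: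
  fixes P :: "'a::alg_closed_field^2^2"
  shows "\<exists>c. det (P - mat c) = 0"
proof -
  have "\<exists>c. poly [:det P, - trace P, 1:] c = 0"
    by (rule alg_closed_imp_poly_has_root) simp
  then obtain c where "poly [:det P, - trace P, 1:] c = 0" by blast
  hence "det (P - mat c) = 0" by (simp add: mat2_simps algebra_simps)
  thus ?thesis by blast
qed

lemma irreducible_commutator:
  fixes P Q :: "'a::alg_closed_field^2^2"
  assumes "irreducible_matrices {P, Q}"
  shows "det (P ** Q - Q ** P) \<noteq> 0"
proof
  assume det: "det (P ** Q - Q ** P) = 0"
  txt \<open>By Cayley--Hamilton the kernel of the commutator is invariant.\<close>
  have "\<exists>N. (P ** Q - Q ** P) ** Z = N ** (P ** Q - Q ** P)" if "Z \<in> {P, Q}" for Z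
  proof
    show "(P ** Q - Q ** P) ** Z = (mat (trace Z) - Z) ** (P ** Q - Q ** P)"
      using that by (auto simp: mat2_simps algebra_simps)
  qed
  hence comm: "P ** Q = Q ** P"
    using invariant_proper_kernel[OF assms _ det] by simp
  \<comment> \<open>Commuting matrices over an algebraically closed field: subtracting an eigenvalue
    leaves a singular matrix that commutes with both, so by Schur both are scalar.\<close>
  obtain c where c: "det (P - mat c) = 0" using exists_eigenvalue by blast
  obtain d where d: "det (Q - mat d) = 0" using exists_eigenvalue by blast
  have "(P - mat c) ** Z = Z ** (P - mat c)" "(Q - mat d) ** Z = Z ** (Q - mat d)"
    if "Z \<in> {P, Q}" for Z
    using that comm by (auto simp: mat2_simps algebra_simps)
  hence "P - mat c = 0" "Q - mat d = 0"
    using invariant_proper_kernel[OF assms _ c] invariant_proper_kernel[OF assms _ d] by blast+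
  hence P: "P = mat c" and Q: "Q = mat d" by simp_all
  \<comment> \<open>A singular nonzero matrix commutes with all scalars, so scalar \<open>P\<close>
    and \<open>Q\<close> contradict irreducibility.\<close>
  let ?M = "(\<chi> i j. if i = 1 \<and> j = 1 then 1 else 0) :: 'a^2^2"
  have "?M = 0"
  proof (rule invariant_proper_kernel[OF assms])
    show "\<exists>N. ?M ** Z = N ** ?M" if "Z \<in> {P, Q}" for Z
      using that by (intro exI[of _ Z]) (auto simp: P Q mat2_simps)
  qed (simp add: det_2)
  thus False by (simp add: mat2_simps)
qed

lemma det_map_matrix_to_ac_2: "det (map_matrix to_ac (P :: 'a::field^2^2)) = to_ac (det P)"
  by (simp add: det_2)

lemma map_matrix_to_ac_mult:
  fixes P Q :: "'a::field^2^2"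
  shows "map_matrix to_ac (P ** Q) = map_matrix to_ac P ** map_matrix to_ac Q"
  by (simp add: mat2_simps)

text \<open>Irreducibility passes from the generated group to its two generators: a subspace
  invariant under \<open>h\<close> is invariant under the inverse too, which is
  \<open>mat (trace h) - h\<close>.\<close>

lemma absolutely_irreducible_commutator:
  fixes P Q :: "'a::field^2^2"
  assumes "absolutely_irreducible (generate SL2 {P, Q})" "det P = 1" "det Q = 1"
  shows "det (P ** Q - Q ** P) \<noteq> 0"
proof -
  interpret group "SL2 :: ('a^2^2) monoid" by (rule group_SL2)
  let ?f = "map_matrix to_ac :: 'a^2^2 \<Rightarrow> _"
  have *: "?f Z *v v \<in> W"
    if W: "vec.subspace W" "\<forall>Z\<in>{?f P, ?f Q}. \<forall>v\<in>W. Z *v v \<in> W"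
      and "Z \<in> generate SL2 {P, Q}" "v \<in> W" for W Z v
    using that(3,4)
  proof (induction Z arbitrary: v rule: generate.induct)
    case one
    moreover have "?f (mat 1) = mat 1" by (simp add: mat2_simps)
    ultimately show ?case by simp
  next
    case (incl h)
    thus ?case using W(2) by auto
  next
    case (inv h)
    hence h: "det h = 1" using assms by auto
    have inv_h: "inv\<^bsub>SL2\<^esub> h = mat (trace h) - h"
      by (rule inv_equality)
        (use h in \<open>simp_all add: mat2_simps algebra_simps\<close>)
    have "?f (inv\<^bsub>SL2\<^esub> h) *v v = to_ac (trace h) *s v - ?f h *v v"
      unfolding inv_h by (simp add: vec_eq_iff[where 'b = 2] forall_2 matrix_vector_mult_def sum_2 trace_2 mat2_nth
          algebra_simps)
    moreover have "?f h *v v \<in> W" using inv W(2) by auto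
    ultimately show ?case
      using W(1) inv.prems by (simp add: vec.subspace_diff vec.subspace_scale)
  next
    case (eng h1 h2)
    thus ?case by (simp add: map_matrix_to_ac_mult matrix_vector_mul_assoc[symmetric])
  qed
  have "irreducible_matrices {?f P, ?f Q}"
    using assms(1) * unfolding absolutely_irreducible_def irreducible_matrices_def by blast
  hence "det (?f P ** ?f Q - ?f Q ** ?f P) \<noteq> 0" by (rule irreducible_commutator)
  moreover have "?f P ** ?f Q - ?f Q ** ?f P = ?f (P ** Q - Q ** P)"
    by (simp add: mat2_simps)
  ultimately show ?thesis by (simp add: det_map_matrix_to_ac_2)
qed

section \<open>The projective group\<close>

lemma to_PSL2_eq: "to_PSL2 P = {P, - P}"
  by (auto simp: to_PSL2_def r_coset_def SL2_centre_def)

lemma to_PSL2_eq_iff: "to_PSL2 P = to_PSL2 Q \<longleftrightarrow> P = Q \<or> P = - Q"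
  unfolding to_PSL2_eq doubleton_eq_iff by (metis minus_minus)

lemma to_PSL2_uminus [simp]: "to_PSL2 (- P) = to_PSL2 P"
  by (simp add: to_PSL2_eq_iff)

lemma group_PSL2: "group (PSL2 :: ('a::field^2^2) set monoid)"
  unfolding PSL2_def using normal_SL2_centre by (rule normal.factorgroup_is_group)

lemma carrier_PSL2: "carrier PSL2 = to_PSL2 ` {P. det P = 1}"
  by (auto simp: PSL2_def FactGroup_def RCOSETS_def to_PSL2_def)

lemma to_PSL2_in_carrier [intro]: "det P = 1 \<Longrightarrow> to_PSL2 P \<in> carrier PSL2"
  by (simp add: carrier_PSL2)

lemma mult_PSL2: "to_PSL2 P \<otimes>\<^bsub>PSL2\<^esub> to_PSL2 Q = to_PSL2 (P ** Q)"
  by (auto simp: PSL2_def FactGroup_def set_mult_def to_PSL2_eq)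

lemma one_PSL2: "\<one>\<^bsub>PSL2\<^esub> = to_PSL2 (mat 1)"
  by (simp add: PSL2_def FactGroup_def to_PSL2_eq SL2_centre_def)

lemma inv_PSL2:
  assumes "det P = 1"
  shows "inv\<^bsub>PSL2\<^esub> to_PSL2 P = to_PSL2 (matrix_inv P)"
proof -
  interpret group "PSL2 :: ('a^2^2) set monoid" by (rule group_PSL2)
  show ?thesis
    by (rule inv_equality) (use assms matrix_inv_SL2[OF assms] in \<open>auto simp: mult_PSL2 one_PSL2\<close>)
qed

lemma uminus_mat: "- (mat c :: 'a::group_add^'n^'n) = mat (- c)"
  by (simp add: mat_def vec_eq_iff)

lemma to_PSL2_eq_one_if_scalar:
  fixes P :: "'a::field^2^2"
  assumes "det P = 1" "P$1$2 = 0" "P$2$1 = 0" "P$1$1 = P$2$2"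
  shows "to_PSL2 P = \<one>\<^bsub>PSL2\<^esub>"
proof -
  have "P$2$2 = 1 \<or> P$2$2 = - 1"
    using assms by (simp add: det_2 square_eq_1_iff)
  hence "P = mat 1 \<or> P = - mat 1"
    using assms by (auto simp: mat2_simps)
  thus ?thesis by (simp add: one_PSL2 to_PSL2_eq_iff)
qed

text \<open>If \<open>P ** P\<close> is scalar, Cayley-Hamilton makes \<open>trace P\<close> times
  \<open>P\<close> scalar; a nonzero trace would make \<open>P\<close> itself scalar, hence trivial
  in PSL(2).\<close>

lemma trace_eq_0_if_involution:
  fixes P :: "'a::field^2^2"
  assumes "det P = 1" "to_PSL2 P \<otimes>\<^bsub>PSL2\<^esub> to_PSL2 P = \<one>\<^bsub>PSL2\<^esub>" "to_PSL2 P \<noteq> \<one>\<^bsub>PSL2\<^esub>"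
  shows "trace P = 0"
proof (rule ccontr)
  assume t: "trace P \<noteq> 0"
  have "P ** P = mat 1 \<or> P ** P = - mat 1"
    using assms(2) by (simp add: mult_PSL2 one_PSL2 to_PSL2_eq_iff)
  then obtain c where c: "P ** P = mat c"
    unfolding uminus_mat by blast
  have "mat (trace P) ** P = mat c + mat 1"
    using mat2_cayley_hamilton[of P] unfolding c assms(1) by simp
  hence "mat (trace P) ** P = mat (c + 1)" by (simp add: mat2_simps)
  hence "trace P * P$1$2 = 0" "trace P * P$2$1 = 0" "trace P * P$1$1 = trace P * P$2$2"
    by (simp_all add: mat2_eq_iff mat2_mult_nth mat2_nth del: mult_cancel_left mult_eq_0_iff)
  thus False using t to_PSL2_eq_one_if_scalar[OF assms(1)] assms(3) by simp
qed

text \<open>As for involutions, now with P^3 = (t^2 - 1) P - t for t = \<open>trace P\<close>: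
  unless t^2 = 1, a scalar cube forces a scalar \<open>P\<close>.\<close>

lemma trace_in_pm_1_if_order_3:
  fixes P :: "'a::field^2^2"
  assumes "det P = 1" "to_PSL2 P \<otimes>\<^bsub>PSL2\<^esub> (to_PSL2 P \<otimes>\<^bsub>PSL2\<^esub> to_PSL2 P) = \<one>\<^bsub>PSL2\<^esub>"
    "to_PSL2 P \<noteq> \<one>\<^bsub>PSL2\<^esub>"
  shows "trace P \<in> pm 1"
proof (rule ccontr)
  assume "trace P \<notin> pm 1"
  hence t: "trace P * trace P - 1 \<noteq> 0"
    by (simp add: pm_def square_eq_1_iff)
  let ?s = "trace P * trace P - 1"
  have "P ** (P ** P) = mat 1 \<or> P ** (P ** P) = - mat 1"
    using assms(2) by (simp add: mult_PSL2 one_PSL2 to_PSL2_eq_iff)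
  then obtain c where c: "P ** (P ** P) = mat c"
    unfolding uminus_mat by blast
  have "P ** (P ** P) = mat (trace P * trace P - det P) ** P - mat (trace P * det P)"
    by (simp add: mat2_simps algebra_simps)
  hence "mat ?s ** P = mat c + mat (trace P)"
    unfolding c assms(1) by simp
  hence "mat ?s ** P = mat (c + trace P)" by (simp add: mat2_simps)
  hence "?s * P$1$2 = 0" "?s * P$2$1 = 0" "?s * P$1$1 = ?s * P$2$2"
    by (simp_all add: mat2_eq_iff mat2_mult_nth mat2_nth del: mult_cancel_left mult_eq_0_iff)
  thus False using t to_PSL2_eq_one_if_scalar[OF assms(1)] assms(3) by simp
qed

section \<open>Quaternion pairs\<close>

locale quaternion_pair =
  fixes B1 B2 :: "'a::field^2^2"
  assumes det_B1: "det B1 = 1" and det_B2: "det B2 = 1"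
    and trace_B1: "trace B1 = 0" and trace_B2: "trace B2 = 0"
    and trace_B1_B2: "trace (B1 ** B2) = 0"
begin

lemma B2_B1: "B2 ** B1 = - (B1 ** B2)"
  using trace_B1 trace_B2 trace_B1_B2 by (rule trace_zero_anticommute)

lemma B1_B1: "B1 ** B1 = - mat 1"
  using mat2_cayley_hamilton[of B1] trace_B1 det_B1 by simp

lemma B2_B2: "B2 ** B2 = - mat 1"
  using mat2_cayley_hamilton[of B2] trace_B2 det_B2 by simp

text \<open>Oriented so that any word in \<open>B1\<close>, \<open>B2\<close> applied to
  \<open>P\<close> reduces, up to sign, to one of the four matrices whose traces make up
  \<open>theta\<close>.\<close>

lemma word_simps:
  "B1 ** (B1 ** P) = - P" "B2 ** (B2 ** P) = - P" "B2 ** (B1 ** P) = - (B1 ** (B2 ** P))"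
  by (simp_all add: matrix_mul_assoc B1_B1 B2_B2 B2_B1)

lemma eq_0_if_theta_eq_0:
  assumes two_neq_0: "(2 :: 'a) \<noteq> 0" and "theta (B1, B2) P = (0, 0, 0, 0)"
  shows "P = 0"
proof -
  have t: "trace P = 0" "trace (B1 ** P) = 0" "trace (B2 ** P) = 0" "trace (B1 ** B2 ** P) = 0"
    using assms(2) by (simp_all add: theta_def)
  txt \<open>Having trace form 0 with \<open>B1\<close>, \<open>B2\<close> and \<open>B1 ** B2\<close>, the traceless \<open>P\<close> anticommutes with all
    three; but anticommuting with the first two, it commutes with the third.\<close>
  have 1: "P ** B1 = - (B1 ** P)" and 2: "P ** B2 = - (B2 ** P)"
    and 3: "P ** (B1 ** B2) = - (B1 ** B2 ** P)"
    using trace_zero_anticommute t trace_B1 trace_B2 trace_B1_B2 by blast+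
  have "P ** (B1 ** B2) = B1 ** B2 ** P"
    by (simp add: matrix_mul_assoc 1) (simp add: matrix_mul_assoc[symmetric] 2)
  with 3 have "B1 ** B2 ** P = - (B1 ** B2 ** P)" by simp
  hence "(B1 ** B2 ** P)$i$j + (B1 ** B2 ** P)$i$j = 0" for i j
    by (metis eq_neg_iff_add_eq_0 vector_uminus_component)
  hence K: "B1 ** B2 ** P = 0"
    using two_neq_0 by (simp add: vec_eq_iff flip: mult_2)
  have "B2 ** (B1 ** (B1 ** B2 ** P)) = P"
    by (simp add: matrix_mul_assoc[symmetric] word_simps)
  thus ?thesis by (simp add: K)
qed

text \<open>Linearity of \<open>theta\<close> in the matrix reduces this to a trivial kernel. From
  here on, matrix identities are checked on coordinates.\<close>

lemma theta_inject:
  assumes "(2 :: 'a) \<noteq> 0" "theta (B1, B2) P = theta (B1, B2) Q"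
  shows "P = Q"
proof -
  have "C ** (P - Q) = C ** P - C ** Q" for C :: "'a^2^2"
    by (simp add: mat2_simps algebra_simps)
  hence "theta (B1, B2) (P - Q) = (0, 0, 0, 0)"
    using assms(2) by (simp add: theta_def trace_sub)
  thus ?thesis using eq_0_if_theta_eq_0[of "P - Q"] assms(1) by simp
qed

lemma theta_mat_1: "theta (B1, B2) (mat 1) = (2, 0, 0, 0)"
  using trace_B1 trace_B2 trace_B1_B2 by (simp add: theta_def trace_2 mat2_nth)

lemma theta_uminus:
  "theta (B1, B2) P = (x0, x1, x2, x3) \<Longrightarrow> theta (B1, B2) (- P) = (- x0, - x1, - x2, - x3)"
  by (auto simp: theta_def)

text \<open>Multiplication by \<open>B1\<close> or \<open>B2\<close> permutes the coordinates up to
  sign, as the quaternion units permute 1, i, j, k.\<close>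

lemma theta_mult_left:
  assumes "theta (B1, B2) P = (x0, x1, x2, x3)"
  shows "theta (B1, B2) (B1 ** P) = (x1, - x0, - x3, x2)"
    and "theta (B1, B2) (B2 ** P) = (x2, x3, - x0, - x1)"
  using assms by (auto simp: theta_def matrix_mul_assoc[symmetric] word_simps)

lemma theta_mult_right:
  assumes "theta (B1, B2) P = (x0, x1, x2, x3)"
  shows "theta (B1, B2) (P ** B1) = (x1, - x0, x3, - x2)"
    and "theta (B1, B2) (P ** B2) = (x2, - x3, - x0, x1)"
proof -
  \<comment> \<open>Cyclicity moves the right factor to the front, where \<open>word_simps\<close>
    applies.\<close>
  have "trace (P ** B) = trace (B ** P)" "trace (C ** (P ** B)) = trace (B ** (C ** P))"
    "trace (C ** (D ** (P ** B))) = trace (B ** (C ** (D ** P)))" for B C D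
    using trace_mul_sym[of P B] trace_mul_sym[of "C ** P" B] trace_mul_sym[of "C ** (D ** P)" B]
    by (simp_all add: matrix_mul_assoc)
  thus "theta (B1, B2) (P ** B1) = (x1, - x0, x3, - x2)"
    and "theta (B1, B2) (P ** B2) = (x2, - x3, - x0, x1)"
    using assms by (auto simp: theta_def matrix_mul_assoc[symmetric] word_simps)
qed

text \<open>Coordinates of x0 P - 1, which is P^2 by Cayley-Hamilton.\<close>

lemma theta_square:
  assumes "theta (B1, B2) P = (x0, x1, x2, x3)" "det P = 1"
  shows "theta (B1, B2) (P ** P) = (x0 * x0 - 2, x0 * x1, x0 * x2, x0 * x3)"
proof -
  have "trace (B ** (P ** P)) = trace P * trace (B ** P) - trace B" for B
    using trace_square_mult[of P B] assms(2) trace_mul_sym[of "P ** P" B] trace_mul_sym[of P B]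
    by simp
  moreover have "trace (P ** P) = trace P * trace P - 2"
    using trace_square_mult[of P "mat 1"] assms(2) by (simp add: trace_2 mat2_nth)
  ultimately show ?thesis
    using assms trace_B1 trace_B2 trace_B1_B2 by (auto simp: theta_def)
qed

end

section \<open>A presentation of the alternating group on four letters\<close>

type_synonym tet = "bool \<times> bool \<times> nat"

text \<open>The triple \<open>(i, j, k)\<close> stands for \<open>b1\<^sup>i b2\<^sup>j c\<^sup>k\<close>, and \<open>tet_conj\<close> for conjugation by \<open>c\<close>,
  which maps \<open>b1\<close> to \<open>b2\<close> and \<open>b2\<close> to \<open>b1 b2\<close>.\<close>

definition tet_conj :: "bool \<times> bool \<Rightarrow> bool \<times> bool" where
  "tet_conj = (\<lambda>(i, j). (j, i \<noteq> j))"

definition tet_set :: "tet set" where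
  "tet_set = UNIV \<times> UNIV \<times> {..<3}"

text \<open>The semidirect product of the Klein four-group by a cyclic group of order 3:
  \<open>(p, q)\<close> results from moving c^k past the second Klein element, and
  \<open>\<noteq>\<close> on booleans is addition modulo 2.\<close>

definition tet_mult :: "tet \<Rightarrow> tet \<Rightarrow> tet" where
  "tet_mult = (\<lambda>(i, j, k) (i', j', k').
     case (tet_conj ^^ k) (i', j') of (p, q) \<Rightarrow> (i \<noteq> p, j \<noteq> q, (k + k') mod 3))"

definition tet_one :: tet where
  "tet_one = (False, False, 0)"

text \<open>The inverse of v c^k is c^(-k) v, since v is an involution or trivial. The outer
  \<open>mod 3\<close> sends the exponent 0 to 0.\<close>

definition tet_inv :: "tet \<Rightarrow> tet" where
  "tet_inv = (\<lambda>(i, j, k). tet_mult (False, False, (3 - k) mod 3) (i, j, 0))"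

definition tet_klein :: "tet set" where
  "tet_klein = UNIV \<times> UNIV \<times> {0}"

text \<open>Facts on this concrete group are proved by exhaustion. The exponent is made explicit so
  that the powers of \<open>tet_conj\<close> evaluate.\<close>

lemma tet_cases:
  assumes "x \<in> tet_set"
  obtains i j where "x = (i, j, 0)" | i j where "x = (i, j, 1)" | i j where "x = (i, j, 2)"
  using assms by (force simp: tet_set_def less_Suc_eq numeral_3_eq_3 numeral_2_eq_2)

lemmas tet_defs = tet_set_def tet_mult_def tet_one_def tet_inv_def tet_klein_def tet_conj_def

lemma tet_closed [simp]:
  "x \<in> tet_set \<Longrightarrow> y \<in> tet_set \<Longrightarrow> tet_mult x y \<in> tet_set" "tet_one \<in> tet_set"
  "x \<in> tet_set \<Longrightarrow> tet_inv x \<in> tet_set"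
  by (auto simp: tet_set_def tet_mult_def tet_one_def tet_inv_def split: prod.splits)

lemma tet_klein_subset: "tet_klein \<subseteq> tet_set"
  by (auto simp: tet_defs)

lemma tet_mult_inv: "x \<in> tet_set \<Longrightarrow> tet_mult x (tet_inv x) = tet_one"
  by (elim tet_cases) (auto simp: tet_defs numeral_2_eq_2)

lemma tet_eq_if_mult_inv:
  "x \<in> tet_set \<Longrightarrow> y \<in> tet_set \<Longrightarrow> tet_mult x (tet_inv y) = tet_one \<Longrightarrow> x = y"
  by (elim tet_cases[of x] tet_cases[of y]) (auto simp: tet_defs numeral_2_eq_2)

lemma tet_klein_square: "x \<in> tet_klein \<Longrightarrow> tet_mult x x = tet_one"
  by (auto simp: tet_defs)

lemma tet_klein_closed: "x \<in> tet_klein \<Longrightarrow> y \<in> tet_klein \<Longrightarrow> tet_mult x y \<in> tet_klein"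
  by (auto simp: tet_defs)

lemma tet_klein_eq:
  "x \<in> tet_klein \<Longrightarrow> y \<in> tet_klein \<Longrightarrow> z \<in> tet_klein \<Longrightarrow> x \<noteq> tet_one \<Longrightarrow> y \<noteq> tet_one \<Longrightarrow> x \<noteq> y
    \<Longrightarrow> z \<in> {tet_one, x, y, tet_mult x y}"
  by (auto simp: tet_defs)

lemma tet_cube:
  "x \<in> tet_set \<Longrightarrow> x \<notin> tet_klein \<Longrightarrow> tet_mult x (tet_mult x x) = tet_one"
  by (elim tet_cases) (auto simp: tet_defs numeral_2_eq_2)

text \<open>An element outside the Klein subgroup permutes its three involutions cyclically and so
  fixes none.\<close>

lemma tet_centralizer:
  "x \<in> tet_klein \<Longrightarrow> y \<in> tet_set \<Longrightarrow> y \<notin> tet_klein \<Longrightarrow> tet_mult x y = tet_mult y x \<Longrightarrow> x = tet_one"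
  by (elim tet_cases[of y]) (auto simp: tet_defs numeral_2_eq_2)

text \<open>Modulo the Klein subgroup the group is cyclic of order 3, so two nontrivial classes are
  either inverse or equal.\<close>

lemma tet_quotient:
  "x \<in> tet_set \<Longrightarrow> y \<in> tet_set \<Longrightarrow> x \<notin> tet_klein \<Longrightarrow> y \<notin> tet_klein \<Longrightarrow>
    tet_mult x y \<in> tet_klein \<or> tet_mult x (tet_inv y) \<in> tet_klein"
  by (elim tet_cases[of x] tet_cases[of y]) (auto simp: tet_defs numeral_2_eq_2)

lemma tet_normal:
  "x \<in> tet_set \<Longrightarrow> y \<in> tet_klein \<Longrightarrow> tet_mult (tet_mult (tet_inv x) y) x \<in> tet_klein"
  by (elim tet_cases[of x]) (auto simp: tet_defs numeral_2_eq_2)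

text \<open>The relations present A_4, and \<open>b1_neq_1\<close> excludes its proper quotients:
  every nontrivial normal subgroup of A_4 contains the Klein subgroup.\<close>

locale tetrahedral_triple = group G for G (structure) +
  fixes b1 b2 c
  assumes carrier [simp]: "b1 \<in> carrier G" "b2 \<in> carrier G" "c \<in> carrier G"
    and b1_b1: "b1 \<otimes> b1 = \<one>" and b2_b2: "b2 \<otimes> b2 = \<one>" and b2_b1: "b2 \<otimes> b1 = b1 \<otimes> b2"
    and c_b1: "c \<otimes> b1 = b2 \<otimes> c" and c_b2: "c \<otimes> b2 = b1 \<otimes> b2 \<otimes> c"
    and c_cube: "c \<otimes> (c \<otimes> c) = \<one>"
    and b1_neq_1: "b1 \<noteq> \<one>"
begin

definition klein :: "bool \<times> bool \<Rightarrow> 'a" where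
  "klein = (\<lambda>(i, j). (if i then b1 else \<one>) \<otimes> (if j then b2 else \<one>))"

definition elem :: "tet \<Rightarrow> 'a" where
  "elem = (\<lambda>(i, j, k). klein (i, j) \<otimes> c [^] k)"

text \<open>Rewriting towards the normal form b1^i b2^j c^k: \<open>c\<close> moves right, and
  \<open>b1\<close> goes before \<open>b2\<close>.\<close>

lemma word_simps:
  assumes "x \<in> carrier G"
  shows "b1 \<otimes> (b1 \<otimes> x) = x" "b2 \<otimes> (b2 \<otimes> x) = x" "b2 \<otimes> (b1 \<otimes> x) = b1 \<otimes> (b2 \<otimes> x)"
    "c \<otimes> (b1 \<otimes> x) = b2 \<otimes> (c \<otimes> x)" "c \<otimes> (b2 \<otimes> x) = b1 \<otimes> (b2 \<otimes> (c \<otimes> x))"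
proof -
  have c_b2': "c \<otimes> b2 = b1 \<otimes> (b2 \<otimes> c)"
    by (simp add: c_b2 m_assoc)
  show "b1 \<otimes> (b1 \<otimes> x) = x" "b2 \<otimes> (b2 \<otimes> x) = x" "b2 \<otimes> (b1 \<otimes> x) = b1 \<otimes> (b2 \<otimes> x)"
    "c \<otimes> (b1 \<otimes> x) = b2 \<otimes> (c \<otimes> x)"
    using assms b1_b1 b2_b2 b2_b1 c_b1 by (simp_all flip: m_assoc)
  have "c \<otimes> (b2 \<otimes> x) = (b1 \<otimes> (b2 \<otimes> c)) \<otimes> x"
    using assms c_b2' by (simp flip: m_assoc)
  thus "c \<otimes> (b2 \<otimes> x) = b1 \<otimes> (b2 \<otimes> (c \<otimes> x))" using assms by (simp add: m_assoc)
qed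

lemma klein_closed [simp]: "klein v \<in> carrier G"
  by (simp add: klein_def split: prod.split)

lemma klein_mult: "klein (i, j) \<otimes> klein (p, q) = klein (i \<noteq> p, j \<noteq> q)"
  by (cases i; cases j; cases p; cases q)
    (simp_all add: klein_def m_assoc word_simps b1_b1 b2_b2 b2_b1)

lemma c_klein: "c \<otimes> klein v = klein (tet_conj v) \<otimes> c"
  by (cases v; cases "fst v"; cases "snd v")
    (simp_all add: klein_def tet_conj_def m_assoc word_simps c_b1 c_b2 b1_b1 b2_b2 b2_b1)

lemma c_pow_klein: "c [^] k \<otimes> klein v = klein ((tet_conj ^^ k) v) \<otimes> c [^] (k::nat)"
proof (induction k)
  case (Suc k)
  have pow: "c [^] Suc k = c \<otimes> c [^] k" by (rule nat_pow_Suc2) simp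
  have "c [^] Suc k \<otimes> klein v = c \<otimes> (c [^] k \<otimes> klein v)"
    unfolding pow by (simp add: m_assoc)
  also have "\<dots> = c \<otimes> klein ((tet_conj ^^ k) v) \<otimes> c [^] k"
    by (simp add: Suc.IH m_assoc)
  also have "\<dots> = klein ((tet_conj ^^ Suc k) v) \<otimes> c [^] Suc k"
    unfolding pow by (simp add: c_klein m_assoc)
  finally show ?case .
qed simp

lemma c_pow_mod_3: "c [^] (k mod 3) = c [^] (k::nat)"
proof -
  have "c [^] (3::nat) = \<one>" using c_cube by (simp add: numeral_3_eq_3 m_assoc)
  hence "c [^] (3 * (k div 3)) = \<one>" by (simp flip: nat_pow_pow)
  moreover have "c [^] k = c [^] (3 * (k div 3)) \<otimes> c [^] (k mod 3)"
    by (simp add: nat_pow_mult)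
  ultimately show ?thesis by simp
qed

lemma elem_closed [simp]: "elem x \<in> carrier G"
  by (simp add: elem_def split: prod.split)

lemma elem_mult: "elem x \<otimes> elem y = elem (tet_mult x y)"
proof -
  obtain i j k i' j' k' where [simp]: "x = (i, j, k)" "y = (i', j', k')"
    by (metis prod_cases3)
  obtain p q where pq: "(tet_conj ^^ k) (i', j') = (p, q)" by fastforce
  have "elem x \<otimes> elem y = klein (i, j) \<otimes> (c [^] k \<otimes> klein (i', j')) \<otimes> c [^] k'"
    by (simp add: elem_def m_assoc)
  also have "\<dots> = (klein (i, j) \<otimes> klein (p, q)) \<otimes> (c [^] k \<otimes> c [^] k')"
    by (simp add: c_pow_klein pq m_assoc)
  finally show ?thesis
    by (simp add: klein_mult nat_pow_mult c_pow_mod_3 elem_def tet_mult_def pq)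
qed

lemma elem_one: "elem tet_one = \<one>"
  by (simp add: elem_def tet_one_def klein_def)

lemma elem_inv:
  assumes "x \<in> tet_set"
  shows "inv (elem x) = elem (tet_inv x)"
proof -
  have "elem x \<otimes> elem (tet_inv x) = \<one>"
    using assms by (simp add: elem_mult tet_mult_inv elem_one)
  thus ?thesis by (metis elem_closed inv_equality inv_unique' r_inv l_inv inv_closed inv_inv)
qed

lemma b1_neq_b2: "b1 \<noteq> b2"
proof
  assume "b1 = b2"
  hence "b2 \<otimes> c = c" using c_b1 c_b2 b1_b1 by simp
  hence "b2 = \<one>" using l_cancel_one' by simp
  thus False using b1_neq_1 \<open>b1 = b2\<close> by simp
qed

lemma b2_neq_1: "b2 \<noteq> \<one>"
  using c_b1 b1_neq_1 l_cancel_one'[of c b1] by auto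

text \<open>The Klein elements commute with \<open>b1\<close>, whereas \<open>c\<close> conjugates
  \<open>b1\<close> to \<open>b2\<close>.\<close>

lemma c_notin_klein: "c \<noteq> klein v"
proof
  assume c: "c = klein v"
  obtain i j where v: "v = (i, j)" by fastforce
  have b1: "b1 = klein (True, False)" by (simp add: klein_def)
  have "c \<otimes> b1 = b1 \<otimes> c"
    unfolding c v by (subst (2 3) b1) (auto simp: klein_mult)
  hence "b1 = b2" using c_b1 by simp
  thus False using b1_neq_b2 by simp
qed

text \<open>For a Klein element v, v c = 1 gives c = v because v^2 = 1, and v c^2 = 1 gives c = v
  c^3 = v. Both put \<open>c\<close> into the Klein subgroup.\<close>

lemma elem_eq_one:
  assumes "x \<in> tet_set" "elem x = \<one>"
  shows "x = tet_one"
  using assms(1)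
proof (cases rule: tet_cases)
  case (1 i j)
  have "b1 \<otimes> b2 \<noteq> \<one>" using b1_neq_b2 b1_b1 l_cancel[of b1 b1 b2] by auto
  thus ?thesis
    using 1 assms(2) b1_neq_1 b2_neq_1
    by (cases i; cases j) (simp_all add: elem_def klein_def tet_one_def)
next
  case (2 i j)
  have "klein (i, j) \<otimes> klein (i, j) = \<one>" by (simp add: klein_mult) (simp add: klein_def)
  hence "c = klein (i, j)"
    using 2 assms(2) l_cancel[of "klein (i, j)" c "klein (i, j)"] by (simp add: elem_def)
  thus ?thesis using c_notin_klein by blast
next
  case (3 i j)
  have "c = klein (i, j) \<otimes> (c \<otimes> c) \<otimes> c"
    using 3 assms(2) by (simp add: elem_def numeral_2_eq_2)
  also have "\<dots> = klein (i, j) \<otimes> (c \<otimes> (c \<otimes> c))" by (simp add: m_assoc)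
  finally show ?thesis using c_notin_klein c_cube by simp
qed

lemma inj_on_elem: "inj_on elem tet_set"
proof (rule inj_onI)
  fix x y assume *: "x \<in> tet_set" "y \<in> tet_set" "elem x = elem y"
  have "elem (tet_mult x (tet_inv y)) = elem (tet_mult y (tet_inv y))"
    using *(3) by (simp flip: elem_mult)
  hence "elem (tet_mult x (tet_inv y)) = \<one>"
    using *(2) by (simp add: tet_mult_inv elem_one)
  hence "tet_mult x (tet_inv y) = tet_one"
    by (rule elem_eq_one[rotated]) (use * in simp)
  with *(1,2) show "x = y" by (rule tet_eq_if_mult_inv)
qed

lemma subgroup_elem: "subgroup (elem ` tet_set) G"
proof
  show "\<one> \<in> elem ` tet_set" by (metis elem_one imageI tet_closed(2))
qed (auto simp: elem_mult elem_inv)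

end

lemma card_tet_set: "card tet_set = 12"
  by (simp add: tet_set_def card_cartesian_product)

text \<open>Normal forms multiply by \<open>tet_mult\<close> in both groups and are unique, so
  matching them is an isomorphism.\<close>

lemma tetrahedral_iso:
  assumes "tetrahedral_triple G b1 b2 c" "carrier G = tetrahedral_triple.elem G b1 b2 c ` tet_set"
    and "tetrahedral_triple H b1' b2' c'" "carrier H = tetrahedral_triple.elem H b1' b2' c' ` tet_set"
  shows "G \<cong> H"
proof -
  interpret G: tetrahedral_triple G b1 b2 c by fact
  interpret H: tetrahedral_triple H b1' b2' c' by fact
  let ?f = "\<lambda>g. H.elem (inv_into tet_set G.elem g)"
  have f: "?f (G.elem x) = H.elem x" if "x \<in> tet_set" for x
    using that G.inj_on_elem by simp
  have "?f \<in> hom G H"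
    unfolding hom_def using assms(2) f by (auto simp: G.elem_mult H.elem_mult)
  moreover have "bij_betw ?f (carrier G) (carrier H)"
  proof (rule bij_betwI')
    fix x y assume "x \<in> carrier G" "y \<in> carrier G"
    thus "?f x = ?f y \<longleftrightarrow> x = y"
      using assms(2) f H.inj_on_elem by (auto simp: inj_on_def)
  qed (use assms(2,4) f in auto)
  ultimately show ?thesis by (auto simp: is_iso_def iso_def)
qed

section \<open>The tetrahedral triple in the alternating group on four letters\<close>

definition alt4_b1 :: "nat \<Rightarrow> nat" where
  "alt4_b1 = Transposition.transpose 1 2 \<circ> Transposition.transpose 3 4"

definition alt4_b2 :: "nat \<Rightarrow> nat" where
  "alt4_b2 = Transposition.transpose 1 3 \<circ> Transposition.transpose 2 4"

text \<open>The 3-cycle 2 -> 3 -> 4 -> 2, which conjugates (12)(34) to (13)(24) and (13)(24) to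
  (14)(23), as the relations demand.\<close>

definition alt4_c :: "nat \<Rightarrow> nat" where
  "alt4_c = Transposition.transpose 2 3 \<circ> Transposition.transpose 3 4"

lemma alt_group_4_transposes:
  assumes "{a, b, c, d} \<subseteq> {1..4}" "a \<noteq> b" "c \<noteq> d"
  shows "Transposition.transpose a b \<circ> Transposition.transpose c d \<in> carrier (alt_group 4)"
  using assms unfolding alt_group_carrier
  by (auto simp: evenperm_comp evenperm_swap permutation_swap_id
      intro!: permutes_compose permutes_swap_id)

lemma tetrahedral_alt_group_4: "tetrahedral_triple (alt_group 4) alt4_b1 alt4_b2 alt4_c"
proof -
  interpret group "alt_group 4" by (rule alt_group_is_group)
  have "alt4_b1 1 \<noteq> id 1" by (simp add: alt4_b1_def Transposition.transpose_def)
  thus ?thesis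
    by unfold_locales
      (auto simp: alt4_b1_def alt4_b2_def alt4_c_def alt_group_mult alt_group_one
        simp del: o_apply intro!: alt_group_4_transposes ext, auto simp: Transposition.transpose_def)
qed

text \<open>By counting: the normal forms are twelve distinct elements of a group of order
  12.\<close>

lemma carrier_alt_group_4:
  "carrier (alt_group 4) =
    tetrahedral_triple.elem (alt_group 4) alt4_b1 alt4_b2 alt4_c ` tet_set"
proof -
  interpret tetrahedral_triple "alt_group 4" alt4_b1 alt4_b2 alt4_c
    by (rule tetrahedral_alt_group_4)
  have "2 * card (carrier (alt_group 4)) = 24"
    using alt_group_card_carrier[of 4] by (simp add: fact_numeral)
  hence "card (carrier (alt_group 4)) = 12" by simp
  \<comment> \<open>An infinite set would have cardinality 0.\<close>
  moreover from this have "finite (carrier (alt_group 4))"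
    using card.infinite by fastforce
  moreover have "card (elem ` tet_set) = 12"
    using card_image[OF inj_on_elem] card_tet_set by simp
  ultimately show ?thesis
    by (intro card_subset_eq[symmetric]) auto
qed

text \<open>Replaces isomorphism with A_4 by a choice of generators satisfying the relations; an
  isomorphism carries the standard triple across.\<close>

lemma tetrahedral_iff_iso_alt_group_4:
  assumes "group H"
  shows "H \<cong> alt_group 4 \<longleftrightarrow>
    (\<exists>b1 b2 c. tetrahedral_triple H b1 b2 c \<and>
      carrier H = tetrahedral_triple.elem H b1 b2 c ` tet_set)"
proof
  assume "H \<cong> alt_group 4"
  hence "alt_group 4 \<cong> H" using assms by (simp add: group.iso_sym)
  then obtain h where h: "h \<in> iso (alt_group 4) H" by (auto simp: is_iso_def)
  interpret A: tetrahedral_triple "alt_group 4" alt4_b1 alt4_b2 alt4_c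
    by (rule tetrahedral_alt_group_4)
  interpret H: group H by fact
  interpret h: group_hom "alt_group 4" H h
    by unfold_locales (use h in \<open>simp add: iso_def\<close>)
  have inj: "inj_on h (carrier (alt_group 4))" and surj: "h ` carrier (alt_group 4) = carrier H"
    using h by (auto simp: iso_def bij_betw_def)
  interpret B: tetrahedral_triple H "h alt4_b1" "h alt4_b2" "h alt4_c"
  proof
    show "h alt4_b1 \<noteq> \<one>\<^bsub>H\<^esub>"
      using inj A.b1_neq_1 inj_onD[OF inj, of alt4_b1 "\<one>\<^bsub>alt_group 4\<^esub>"] by auto
  qed (simp_all flip: h.hom_mult add: A.b1_b1 A.b2_b2 A.b2_b1 A.c_b1 A.c_b2 A.c_cube)
  have "h (A.elem x) = B.elem x" for x
    by (simp add: A.elem_def B.elem_def A.klein_def B.klein_def h.hom_nat_pow split: prod.split)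
  hence "carrier H = B.elem ` tet_set"
    using surj carrier_alt_group_4 by (metis (no_types, lifting) image_image image_cong)
  thus "\<exists>b1 b2 c. tetrahedral_triple H b1 b2 c \<and>
      carrier H = tetrahedral_triple.elem H b1 b2 c ` tet_set"
    using B.tetrahedral_triple_axioms by blast
next
  assume "\<exists>b1 b2 c. tetrahedral_triple H b1 b2 c \<and>
      carrier H = tetrahedral_triple.elem H b1 b2 c ` tet_set"
  thus "H \<cong> alt_group 4"
    using tetrahedral_iso tetrahedral_alt_group_4 carrier_alt_group_4 by metis
qed

section \<open>The Klein subgroup\<close>

text \<open>What the trace arguments use of the Klein subgroup of A_4, freed from any choice of
  generators.\<close>

locale alt4_klein = group H for H (structure) +
  fixes V
  assumes V_subset: "V \<subseteq> carrier H" and V_proper: "\<not> carrier H \<subseteq> V" and V_one: "\<one> \<in> V"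
    and V_mult: "u \<in> V \<Longrightarrow> v \<in> V \<Longrightarrow> u \<otimes> v \<in> V"
    and V_square: "u \<in> V \<Longrightarrow> u \<otimes> u = \<one>"
    and V_eq: "u \<in> V \<Longrightarrow> v \<in> V \<Longrightarrow> w \<in> V \<Longrightarrow> u \<noteq> \<one> \<Longrightarrow> v \<noteq> \<one> \<Longrightarrow> u \<noteq> v
      \<Longrightarrow> w \<in> {\<one>, u, v, u \<otimes> v}"
    and cube: "x \<in> carrier H \<Longrightarrow> x \<notin> V \<Longrightarrow> x \<otimes> (x \<otimes> x) = \<one>"
    and centralizer: "u \<in> V \<Longrightarrow> x \<in> carrier H \<Longrightarrow> x \<notin> V \<Longrightarrow> u \<otimes> x = x \<otimes> u \<Longrightarrow> u = \<one>"
    and quotient: "x \<in> carrier H \<Longrightarrow> y \<in> carrier H \<Longrightarrow> x \<notin> V \<Longrightarrow> y \<notin> V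
      \<Longrightarrow> x \<otimes> y \<in> V \<or> x \<otimes> inv y \<in> V"
    and V_normal: "x \<in> carrier H \<Longrightarrow> u \<in> V \<Longrightarrow> inv x \<otimes> u \<otimes> x \<in> V"
begin

lemma V_inv: "u \<in> V \<Longrightarrow> inv u = u"
  using V_square V_subset inv_equality by blast

lemma subgroup_V: "subgroup V H"
  using V_subset V_one V_mult V_inv by unfold_locales auto

lemma mult_notin_V:
  assumes "u \<in> V" "x \<in> carrier H" "x \<notin> V"
  shows "u \<otimes> x \<notin> V"
proof
  assume "u \<otimes> x \<in> V"
  hence "u \<otimes> (u \<otimes> x) \<in> V" using assms(1) V_mult by blast
  moreover have "u \<otimes> (u \<otimes> x) = x"
    using assms V_square V_subset by (simp add: subset_iff flip: m_assoc)
  ultimately show False using assms(3) by simp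
qed

lemma inv_notin_V: "x \<in> carrier H \<Longrightarrow> x \<notin> V \<Longrightarrow> inv x \<notin> V"
  using subgroup.m_inv_closed[OF subgroup_V, of "inv x"] by auto

end

text \<open>The image of \<open>tet_klein\<close> serves as \<open>V\<close>; injectivity of
  \<open>elem\<close> transfers each property from the concrete group.\<close>

lemma alt4_klein_exists:
  assumes "group H" "H \<cong> alt_group 4"
  shows "\<exists>V. alt4_klein H V"
proof -
  obtain b1 b2 c where bc: "tetrahedral_triple H b1 b2 c"
    "carrier H = tetrahedral_triple.elem H b1 b2 c ` tet_set"
    using assms tetrahedral_iff_iso_alt_group_4 by blast
  interpret tetrahedral_triple H b1 b2 c by fact
  have eq: "elem x = elem y \<longleftrightarrow> x = y" if "x \<in> tet_set" "y \<in> tet_set" for x y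
    using that inj_on_elem by (auto simp: inj_on_def)
  have carrierE: "\<exists>x\<in>tet_set. g = elem x" if "g \<in> carrier H" for g
    using that bc(2) by auto
  let ?V = "elem ` tet_klein"
  have VE: "\<exists>x\<in>tet_klein. g = elem x" if "g \<in> ?V" for g
    using that by auto
  have K: "x \<in> tet_set" if "x \<in> tet_klein" for x
    using that tet_klein_subset by blast
  have mem: "elem x \<in> ?V \<longleftrightarrow> x \<in> tet_klein" if "x \<in> tet_set" for x
    using that by (rule inj_on_image_mem_iff[OF inj_on_elem _ tet_klein_subset])
  have one: "elem x = \<one>\<^bsub>H\<^esub> \<longleftrightarrow> x = tet_one" if "x \<in> tet_set" for x
    using eq[OF that, of tet_one] by (simp add: elem_one)
  have "alt4_klein H ?V"
  proof
    show "?V \<subseteq> carrier H" by auto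
    show "\<not> carrier H \<subseteq> ?V"
    proof
      assume "carrier H \<subseteq> ?V"
      hence "elem (False, False, 1) \<in> ?V" using elem_closed by blast
      thus False using mem[of "(False, False, 1)"] by (simp add: tet_defs)
    qed
    show "\<one>\<^bsub>H\<^esub> \<in> ?V"
      unfolding elem_one[symmetric] by (rule imageI) (simp add: tet_defs)
    fix u v assume u: "u \<in> ?V" and v: "v \<in> ?V"
    show "u \<otimes>\<^bsub>H\<^esub> v \<in> ?V"
      using VE[OF u] VE[OF v] by (auto simp: elem_mult intro: tet_klein_closed)
    show "u \<otimes>\<^bsub>H\<^esub> u = \<one>\<^bsub>H\<^esub>"
      using VE[OF u] by (auto simp: elem_mult tet_klein_square elem_one)
    fix w assume "w \<in> ?V" "u \<noteq> \<one>\<^bsub>H\<^esub>" "v \<noteq> \<one>\<^bsub>H\<^esub>" "u \<noteq> v"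
    moreover from this u v obtain x y z where xyz: "x \<in> tet_klein" "u = elem x"
      "y \<in> tet_klein" "v = elem y" "z \<in> tet_klein" "w = elem z"
      using VE by blast
    ultimately have "x \<noteq> tet_one" "y \<noteq> tet_one" "x \<noteq> y"
      using elem_one by auto
    with xyz have "z \<in> {tet_one, x, y, tet_mult x y}" by (intro tet_klein_eq)
    thus "w \<in> {\<one>\<^bsub>H\<^esub>, u, v, u \<otimes>\<^bsub>H\<^esub> v}"
      by (auto simp: xyz elem_mult elem_one)
  next
    fix x assume "x \<in> carrier H" "x \<notin> ?V"
    then obtain p where p: "p \<in> tet_set" "x = elem p" "p \<notin> tet_klein"
      using carrierE by blast
    show "x \<otimes>\<^bsub>H\<^esub> (x \<otimes>\<^bsub>H\<^esub> x) = \<one>\<^bsub>H\<^esub>"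
      using p by (simp add: elem_mult tet_cube elem_one)
  next
    fix u x assume "u \<in> ?V" "x \<in> carrier H" "x \<notin> ?V" "u \<otimes>\<^bsub>H\<^esub> x = x \<otimes>\<^bsub>H\<^esub> u"
    moreover from this obtain p q where p: "p \<in> tet_set" "x = elem p" "p \<notin> tet_klein"
      "q \<in> tet_klein" "u = elem q"
      using carrierE by blast
    ultimately show "u = \<one>\<^bsub>H\<^esub>"
      using tet_centralizer[of q p] by (simp add: elem_mult eq K one)
  next
    fix x y assume "x \<in> carrier H" "y \<in> carrier H" "x \<notin> ?V" "y \<notin> ?V"
    then obtain p q where p: "p \<in> tet_set" "x = elem p" "p \<notin> tet_klein"
      "q \<in> tet_set" "y = elem q" "q \<notin> tet_klein"
      using carrierE by (metis imageI)
    thus "x \<otimes>\<^bsub>H\<^esub> y \<in> ?V \<or> x \<otimes>\<^bsub>H\<^esub> inv\<^bsub>H\<^esub> y \<in> ?V"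
      using tet_quotient[of p q] by (simp add: elem_mult elem_inv mem)
  next
    fix x u assume "x \<in> carrier H" "u \<in> ?V"
    then obtain p q where p: "p \<in> tet_set" "x = elem p" "q \<in> tet_klein" "u = elem q"
      using carrierE by blast
    thus "inv\<^bsub>H\<^esub> x \<otimes>\<^bsub>H\<^esub> u \<otimes>\<^bsub>H\<^esub> x \<in> ?V"
      using tet_normal[of p q] by (simp add: elem_mult elem_inv mem K)
  qed
  thus ?thesis by blast
qed

section \<open>Traces in a subgroup of PSL(2,q) isomorphic to A_4\<close>

context quaternion_pair
begin

lemma theta_B1: "theta (B1, B2) B1 = (0, - 2, 0, 0)"
  using theta_mult_left(1)[OF theta_mat_1] by simp

lemma theta_B2: "theta (B1, B2) B2 = (0, 0, - 2, 0)"
  using theta_mult_left(2)[OF theta_mat_1] by simp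

lemma theta_B1_B2: "theta (B1, B2) (B1 ** B2) = (0, 0, 0, - 2)"
  using theta_mult_left(1)[OF theta_B2] by simp

lemma theta_klein_in_Theta4:
  assumes "to_PSL2 P \<in> {\<one>\<^bsub>PSL2\<^esub>, to_PSL2 B1, to_PSL2 B2, to_PSL2 (B1 ** B2)}"
  shows "theta (B1, B2) P \<in> Theta4"
proof -
  have "P = Q \<or> P = - Q \<Longrightarrow> theta (B1, B2) Q = (x0, x1, x2, x3) \<Longrightarrow>
      theta (B1, B2) P \<in> {(x0, x1, x2, x3), (- x0, - x1, - x2, - x3)}" for Q x0 x1 x2 x3
    using theta_uminus by auto
  note this[OF _ theta_mat_1] this[OF _ theta_B1] this[OF _ theta_B2]
    this[OF _ theta_B1_B2]
  thus ?thesis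
    using assms by (auto simp: one_PSL2 to_PSL2_eq_iff Theta4_def pm_def)
qed

end

locale alt4_klein_PSL2 =
  alt4_klein "subgroup_generated (PSL2 :: ('a::field^2^2) set monoid) S" V for S V
begin

abbreviation "\<Gamma> \<equiv> carrier (subgroup_generated (PSL2 :: ('a^2^2) set monoid) S)"

lemma trace_in_V:
  assumes "det P = 1" "to_PSL2 P \<in> V" "to_PSL2 P \<noteq> \<one>\<^bsub>PSL2\<^esub>"
  shows "trace P = 0"
  using assms V_square[OF assms(2)] by (intro trace_eq_0_if_involution) auto

lemma trace_notin_V:
  assumes "det P = 1" "to_PSL2 P \<in> \<Gamma>" "to_PSL2 P \<notin> V"
  shows "trace P \<in> pm 1"
  using assms cube[OF assms(2,3)] V_one by (intro trace_in_pm_1_if_order_3) auto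

definition base_pair :: "'a^2^2 \<Rightarrow> 'a^2^2 \<Rightarrow> bool" where
  "base_pair B1 B2 \<longleftrightarrow> det B1 = 1 \<and> det B2 = 1 \<and> to_PSL2 B1 \<in> V \<and> to_PSL2 B2 \<in> V \<and>
    to_PSL2 B1 \<noteq> \<one>\<^bsub>PSL2\<^esub> \<and> to_PSL2 B2 \<noteq> \<one>\<^bsub>PSL2\<^esub> \<and> to_PSL2 B1 \<noteq> to_PSL2 B2"

text \<open>Two distinct involutions of \<open>V\<close> have a nontrivial product in
  \<open>V\<close>, so \<open>B1\<close>, \<open>B2\<close> and \<open>B1 ** B2\<close> all lift
  involutions.\<close>

lemma base_pair_quaternion:
  assumes "base_pair B1 B2"
  shows "quaternion_pair B1 B2"
proof
  interpret PSL2: group "PSL2 :: ('a^2^2) set monoid" by (rule group_PSL2)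
  note B = assms[unfolded base_pair_def]
  show "det B1 = 1" "det B2 = 1" "trace B1 = 0" "trace B2 = 0"
    using B trace_in_V by auto
  have "to_PSL2 B1 \<otimes>\<^bsub>PSL2\<^esub> to_PSL2 B2 \<noteq> to_PSL2 B1 \<otimes>\<^bsub>PSL2\<^esub> to_PSL2 B1"
    using B PSL2.l_cancel[of "to_PSL2 B1" "to_PSL2 B2" "to_PSL2 B1"]
    by (metis to_PSL2_in_carrier)
  moreover have "to_PSL2 B1 \<otimes>\<^bsub>PSL2\<^esub> to_PSL2 B1 = \<one>\<^bsub>PSL2\<^esub>"
    using B V_square by simp
  moreover have "to_PSL2 B1 \<otimes>\<^bsub>PSL2\<^esub> to_PSL2 B2 \<in> V"
    using B V_mult by simp
  ultimately show "trace (B1 ** B2) = 0"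
    using B by (intro trace_in_V) (simp_all add: det_mul mult_PSL2)
qed

text \<open>The coset of \<open>V\<close> through the image of \<open>P\<close> lies outside
  \<open>V\<close>, so each of the four matrices in \<open>theta\<close> lifts an element of order
  3.\<close>

lemma theta_notin_V:
  assumes "base_pair B1 B2" "det P = 1" "to_PSL2 P \<in> \<Gamma>" "to_PSL2 P \<notin> V"
  shows "theta (B1, B2) P \<in> Theta4_ones"
proof -
  note B = assms(1)[unfolded base_pair_def]
  have *: "trace (C ** P) \<in> pm 1" if "det C = 1" "to_PSL2 C \<in> V" for C
  proof (rule trace_notin_V)
    show "to_PSL2 (C ** P) \<in> \<Gamma>"
      using assms(3) that(2) V_subset m_closed[of "to_PSL2 C" "to_PSL2 P"] by (auto simp: mult_PSL2)
    show "to_PSL2 (C ** P) \<notin> V"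
      using assms(3,4) that(2) mult_notin_V[of "to_PSL2 C" "to_PSL2 P"] by (simp add: mult_PSL2)
  qed (use assms that in \<open>simp add: det_mul\<close>)
  have "to_PSL2 (B1 ** B2) \<in> V"
    using B V_mult[of "to_PSL2 B1" "to_PSL2 B2"] by (simp add: mult_PSL2)
  thus ?thesis
    using B *[of B1] *[of B2] *[of "B1 ** B2"] trace_notin_V[OF assms(2-4)]
    by (simp add: theta_def Theta4_ones_def det_mul)
qed

lemma theta_in_Theta4:
  assumes "base_pair B1 B2" "det P = 1" "to_PSL2 P \<in> \<Gamma>"
  shows "theta (B1, B2) P \<in> Theta4"
proof (cases "to_PSL2 P \<in> V")
  case True
  interpret quaternion_pair B1 B2 by (rule base_pair_quaternion) fact
  show ?thesis
    using assms(1) V_eq[OF _ _ True, of "to_PSL2 B1" "to_PSL2 B2"] unfolding base_pair_def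
    by (intro theta_klein_in_Theta4) (simp add: mult_PSL2)
next
  case False
  thus ?thesis using theta_notin_V[OF assms] by (simp add: Theta4_def)
qed

text \<open>Elements outside \<open>V\<close> centralize no involution of \<open>V\<close>, so
  conjugating by \<open>Q\<close> yields a second involution. Cases (2) to (5) all come from this,
  with different \<open>P\<close> and \<open>Q\<close>.\<close>

lemma conjugate_base_pair:
  assumes "det P = 1" "det Q = 1" "to_PSL2 P \<in> V" "to_PSL2 P \<noteq> \<one>\<^bsub>PSL2\<^esub>"
    "to_PSL2 Q \<in> \<Gamma>" "to_PSL2 Q \<notin> V"
  shows "base_pair P (matrix_inv Q ** P ** Q)"
    and "trace P = 0" "trace Q \<in> pm 1" "trace (P ** Q) \<in> pm 1"
proof -
  interpret PSL2: group "PSL2 :: ('a^2^2) set monoid" by (rule group_PSL2)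
  let ?p = "to_PSL2 P" and ?q = "to_PSL2 Q"
  have carrier: "?p \<in> carrier PSL2" "?q \<in> carrier PSL2" using assms by auto
  have inv: "to_PSL2 (matrix_inv Q) = inv\<^bsub>PSL2\<^esub> ?q"
    using assms by (simp add: inv_PSL2)
  have "inv\<^bsub>PSL2\<^esub> ?q \<otimes>\<^bsub>PSL2\<^esub> ?p \<otimes>\<^bsub>PSL2\<^esub> ?q \<in> V"
    using V_normal[OF assms(5,3)] assms(5) by simp
  moreover have "inv\<^bsub>PSL2\<^esub> ?q \<otimes>\<^bsub>PSL2\<^esub> ?p \<otimes>\<^bsub>PSL2\<^esub> ?q \<noteq> \<one>\<^bsub>PSL2\<^esub>"
    using assms(4) carrier
    by (metis PSL2.inv_closed PSL2.inv_equality PSL2.inv_inv PSL2.m_assoc PSL2.m_closed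
        PSL2.r_cancel_one PSL2.inv_solve_left PSL2.r_one)
  moreover have "inv\<^bsub>PSL2\<^esub> ?q \<otimes>\<^bsub>PSL2\<^esub> ?p \<otimes>\<^bsub>PSL2\<^esub> ?q \<noteq> ?p"
  proof
    assume "inv\<^bsub>PSL2\<^esub> ?q \<otimes>\<^bsub>PSL2\<^esub> ?p \<otimes>\<^bsub>PSL2\<^esub> ?q = ?p"
    hence "?p \<otimes>\<^bsub>PSL2\<^esub> ?q = ?q \<otimes>\<^bsub>PSL2\<^esub> ?p"
      using carrier by (metis PSL2.inv_closed PSL2.inv_solve_left PSL2.m_assoc PSL2.m_closed)
    thus False using centralizer[OF assms(3,5,6)] assms(4) by simp
  qed
  ultimately show "base_pair P (matrix_inv Q ** P ** Q)"
    using assms unfolding base_pair_def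
    by (auto simp: det_mul matrix_inv_SL2(3) inv simp flip: mult_PSL2)
  show "trace P = 0" "trace Q \<in> pm 1"
    using assms trace_in_V trace_notin_V by auto
  have "to_PSL2 (P ** Q) \<in> \<Gamma>" "to_PSL2 (P ** Q) \<notin> V"
    using assms V_subset m_closed[of ?p ?q] mult_notin_V[of ?p ?q] by (auto simp: mult_PSL2)
  thus "trace (P ** Q) \<in> pm 1"
    using assms by (intro trace_notin_V) (simp_all add: det_mul)
qed

end

section \<open>The binary tetrahedral group of a quaternion pair\<close>

context quaternion_pair
begin

lemma to_PSL2_B1_neq_1: "(2 :: 'a) \<noteq> 0 \<Longrightarrow> to_PSL2 B1 \<noteq> \<one>\<^bsub>PSL2\<^esub>"
  using trace_B1 by (auto simp: one_PSL2 to_PSL2_eq_iff trace_2 mat2_nth)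

text \<open>By \<open>theta_inject\<close>, a relation in PSL(2) follows once the coordinates of its
  two sides agree up to a common sign.\<close>

lemma tetrahedral_triple_PSL2:
  assumes two: "(2 :: 'a) \<noteq> 0" and "det C = 1" and C: "theta (B1, B2) C = (e0, e1, e2, e3)"
    and "{e0, e1, e2, e3} \<subseteq> pm 1" and "e0 * e1 * e2 * e3 = - 1"
  shows "tetrahedral_triple PSL2 (to_PSL2 B1) (to_PSL2 B2) (to_PSL2 C)"
proof -
  interpret group "PSL2 :: ('a^2^2) set monoid" by (rule group_PSL2)
  have e: "e0 = 1 \<or> e0 = - 1" "e1 = 1 \<or> e1 = - 1" "e2 = 1 \<or> e2 = - 1" "e3 = 1 \<or> e3 = - 1"
    using assms(4) by (auto simp: pm_def)
  have neg1: "(1 :: 'a) \<noteq> - 1" "(- 1 :: 'a) \<noteq> 1"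
    using two by (simp_all add: eq_neg_iff_add_eq_0 neg_eq_iff_add_eq_0)
  have B1_C: "theta (B1, B2) (C ** B1) = (e1, - e0, e3, - e2)"
    and B2_C: "theta (B1, B2) (C ** B2) = (e2, - e3, - e0, e1)"
    using theta_mult_right[OF C] by blast+
  have C_B2: "theta (B1, B2) (B2 ** C) = (e2, e3, - e0, - e1)"
    using theta_mult_left[OF C] by blast
  have C_K: "theta (B1, B2) (B1 ** (B2 ** C)) = (e3, - e2, e1, - e0)"
    using theta_mult_left(1)[OF C_B2] by simp
  \<comment> \<open>Agreement up to a common sign amounts to e1 e2 = - e0 e3, that is, to the
    product of all four being -1.\<close>
  have "theta (B1, B2) (C ** B1) = theta (B1, B2) (B2 ** C) \<or>
      theta (B1, B2) (C ** B1) = theta (B1, B2) (- (B2 ** C))"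
    unfolding B1_C C_B2 theta_uminus[OF C_B2] using assms(5) e neg1 by auto
  hence 1: "C ** B1 = B2 ** C \<or> C ** B1 = - (B2 ** C)"
    using theta_inject[OF two] by blast
  have "theta (B1, B2) (C ** B2) = theta (B1, B2) (B1 ** (B2 ** C)) \<or>
      theta (B1, B2) (C ** B2) = theta (B1, B2) (- (B1 ** (B2 ** C)))"
    unfolding B2_C C_K theta_uminus[OF C_K] using assms(5) e neg1 by auto
  hence 2: "C ** B2 = B1 ** B2 ** C \<or> C ** B2 = - (B1 ** B2 ** C)"
    using theta_inject[OF two] unfolding matrix_mul_assoc[symmetric] by blast
  \<comment> \<open>With t = \<open>trace C\<close>, the coefficient t^2 - 1 of \<open>C\<close> in
    C^3 = (t^2 - 1) C - t vanishes.\<close>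
  have "trace C * trace C = 1" using C e by (auto simp: theta_def)
  moreover have "C ** (C ** C) = mat (trace C * trace C - det C) ** C - mat (trace C * det C)"
    by (simp add: mat2_simps algebra_simps)
  ultimately have "C ** (C ** C) = - mat (trace C)"
    using \<open>det C = 1\<close> by simp
  hence 3: "C ** (C ** C) = mat 1 \<or> C ** (C ** C) = - mat 1"
    using C e by (auto simp: theta_def uminus_mat)
  show ?thesis
    by unfold_locales
      (simp_all add: to_PSL2_in_carrier det_B1 det_B2 \<open>det C = 1\<close> mult_PSL2 B1_B1 B2_B2 B2_B1
        one_PSL2 to_PSL2_eq_iff 1 2 3 to_PSL2_B1_neq_1[OF two, unfolded one_PSL2 to_PSL2_eq_iff])
qed

text \<open>There are eight sign vectors with a given product, four up to a global sign. Left
  multiplication by 1, \<open>B1\<close>, \<open>B2\<close>, \<open>B1 ** B2\<close> preserves the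
  product and reaches all four.\<close>

lemma klein_coset:
  assumes two: "(2 :: 'a) \<noteq> 0"
    and P: "theta (B1, B2) P = (d0, d1, d2, d3)" "{d0, d1, d2, d3} \<subseteq> pm 1"
    and D: "theta (B1, B2) D = (f0, f1, f2, f3)" "{f0, f1, f2, f3} \<subseteq> pm 1"
    and "d0 * d1 * d2 * d3 = f0 * f1 * f2 * f3"
  shows "to_PSL2 P \<in> to_PSL2 ` {D, B1 ** D, B2 ** D, B1 ** (B2 ** D)}"
proof -
  have f: "f0 = 1 \<or> f0 = - 1" "f1 = 1 \<or> f1 = - 1" "f2 = 1 \<or> f2 = - 1" "f3 = 1 \<or> f3 = - 1"
    using D(2) by (auto simp: pm_def)
  have d: "d0 = 1 \<or> d0 = - 1" "d1 = 1 \<or> d1 = - 1" "d2 = 1 \<or> d2 = - 1" "d3 = 1 \<or> d3 = - 1"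
    using P(2) by (auto simp: pm_def)
  have neg1: "(1 :: 'a) \<noteq> - 1" "(- 1 :: 'a) \<noteq> 1"
    using two by (simp_all add: eq_neg_iff_add_eq_0 neg_eq_iff_add_eq_0)
  note D1 = theta_mult_left(1)[OF D(1)] and D2 = theta_mult_left(2)[OF D(1)]
  note D3 = theta_mult_left(1)[OF D2]
  let ?L = "{(f0, f1, f2, f3), (f1, - f0, - f3, f2), (f2, f3, - f0, - f1), (f3, - f2, f1, - f0)}"
  have "(d0, d1, d2, d3) \<in> ?L \<or> (- d0, - d1, - d2, - d3) \<in> ?L"
    using d f
    by (elim disjE) (use assms(6) neg1 in simp_all)
  hence "theta (B1, B2) P \<in> ?L \<or> theta (B1, B2) (- P) \<in> ?L"
    by (simp only: P theta_uminus[OF P(1)])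
  hence "\<exists>E \<in> {D, B1 ** D, B2 ** D, B1 ** (B2 ** D)}.
      theta (B1, B2) P = theta (B1, B2) E \<or> theta (B1, B2) (- P) = theta (B1, B2) E"
    using D D1 D2 D3 by auto
  hence "\<exists>E \<in> {D, B1 ** D, B2 ** D, B1 ** (B2 ** D)}. P = E \<or> - P = E"
    using theta_inject[OF two] by blast
  hence "\<exists>E \<in> {D, B1 ** D, B2 ** D, B1 ** (B2 ** D)}. to_PSL2 P = to_PSL2 E"
    by (metis to_PSL2_uminus)
  thus ?thesis by blast
qed

lemma Theta4_cases:
  assumes two: "(2 :: 'a) \<noteq> 0" and "theta (B1, B2) P \<in> Theta4"
  obtains "to_PSL2 P \<in> to_PSL2 ` {mat 1, B1, B2, B1 ** B2}"
    | d0 d1 d2 d3 where "theta (B1, B2) P = (d0, d1, d2, d3)" "{d0, d1, d2, d3} \<subseteq> pm 1"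
proof (cases "theta (B1, B2) P \<in> Theta4_ones")
  case True
  thus ?thesis using that(2) by (auto simp: Theta4_ones_def)
next
  case False
  have "P = E \<or> P = - E"
    if "theta (B1, B2) E = (e0, e1, e2, e3)"
      "theta (B1, B2) P \<in> {(e0, e1, e2, e3), (- e0, - e1, - e2, - e3)}" for E e0 e1 e2 e3
    using theta_inject[OF two, of P E] theta_inject[OF two, of P "- E"] that theta_uminus[OF that(1)]
    by auto
  note * = this[OF theta_mat_1] this[OF theta_B1] this[OF theta_B2]
    this[OF theta_B1_B2]
  \<comment> \<open>Entries such as \<open>- 0\<close> stay unevaluated to match the instances
    collected in \<open>*\<close>.\<close>
  have "theta (B1, B2) P \<in> {(2, 0, 0, 0), (- 2, - 0, - 0, - 0)} \<or>
      theta (B1, B2) P \<in> {(0, - 2, 0, 0), (- 0, - (- 2), - 0, - 0)} \<or>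
      theta (B1, B2) P \<in> {(0, 0, - 2, 0), (- 0, - 0, - (- 2), - 0)} \<or>
      theta (B1, B2) P \<in> {(0, 0, 0, - 2), (- 0, - 0, - 0, - (- 2))}"
    using assms(2) False unfolding Theta4_def pm_def by auto
  hence "\<exists>E \<in> {mat 1, B1, B2, B1 ** B2}. P = E \<or> P = - E"
    using * by blast
  thus ?thesis using that(1) by (auto simp: to_PSL2_eq_iff)
qed

definition Tet :: "('a^2^2) set set" where
  "Tet = to_PSL2 ` {P. det P = 1 \<and> theta (B1, B2) P \<in> Theta4}"

text \<open>The three kinds of element of \<open>Tet\<close> are the three cosets of the Klein
  subgroup: sign product -1 gives that of \<open>C\<close>, and product 1 that of
  \<open>C ** C\<close>.\<close>

lemma Tet_subset_elem:
  assumes two: "(2 :: 'a) \<noteq> 0" and "det C = 1" and C: "theta (B1, B2) C = (e0, e1, e2, e3)"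
    and e: "{e0, e1, e2, e3} \<subseteq> pm 1" and "e0 * e1 * e2 * e3 = - 1"
  shows "Tet \<subseteq> tetrahedral_triple.elem PSL2 (to_PSL2 B1) (to_PSL2 B2) (to_PSL2 C) ` tet_set"
proof -
  interpret tetrahedral_triple PSL2 "to_PSL2 B1" "to_PSL2 B2" "to_PSL2 C"
    using assms by (rule tetrahedral_triple_PSL2)
  have e_square: "e0 * e0 = 1" "e1 * e1 = 1" "e2 * e2 = 1" "e3 * e3 = 1"
    using e by (auto simp: pm_def)
  have pow_closed: "to_PSL2 C [^]\<^bsub>PSL2\<^esub> k \<in> carrier PSL2" for k :: nat by simp
  have coset: "to_PSL2 ` {D, B1 ** D, B2 ** D, B1 ** (B2 ** D)} \<subseteq> elem ` tet_set"
    if "to_PSL2 D = to_PSL2 C [^]\<^bsub>PSL2\<^esub> k" "k < 3" for D and k :: nat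
  proof -
    have "to_PSL2 D = elem (False, False, k)" "to_PSL2 (B1 ** D) = elem (True, False, k)"
      "to_PSL2 (B2 ** D) = elem (False, True, k)" "to_PSL2 (B1 ** (B2 ** D)) = elem (True, True, k)"
      using that(1) by (simp_all add: elem_def klein_def m_assoc flip: mult_PSL2)
    thus ?thesis using that(2) by (auto simp: tet_set_def)
  qed
  have "to_PSL2 P \<in> elem ` tet_set" if P: "det P = 1" "theta (B1, B2) P \<in> Theta4" for P
  proof (rule Theta4_cases[OF two P(2)])
    assume "to_PSL2 P \<in> to_PSL2 ` {mat 1, B1, B2, B1 ** B2}"
    moreover have "to_PSL2 ` {mat 1, B1, B2, B1 ** B2} \<subseteq> elem ` tet_set"
      using coset[of "mat 1" 0] by (simp add: one_PSL2)
    ultimately show ?thesis by blast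
  next
    fix d0 d1 d2 d3 assume d: "theta (B1, B2) P = (d0, d1, d2, d3)" "{d0, d1, d2, d3} \<subseteq> pm 1"
    have "d0 * d1 * d2 * d3 = - 1 \<or> d0 * d1 * d2 * d3 = 1"
      using d(2) by (auto simp: pm_def)
    thus ?thesis
    proof
      assume "d0 * d1 * d2 * d3 = - 1"
      hence "to_PSL2 P \<in> to_PSL2 ` {C, B1 ** C, B2 ** C, B1 ** (B2 ** C)}"
        using klein_coset[OF two d C e] assms(5) by simp
      thus ?thesis using coset[of C 1] by auto
    next
      assume 1: "d0 * d1 * d2 * d3 = 1"
      \<comment> \<open>The first entry is e0^2 - 2 = -1; the sign product of the square is then
        opposite to that of \<open>C\<close>.\<close>
      have C_C: "theta (B1, B2) (C ** C) = (- 1, e0 * e1, e0 * e2, e0 * e3)"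
        using theta_square[OF C \<open>det C = 1\<close>] by (simp add: e_square)
      have "(- 1) * (e0 * e1) * (e0 * e2) * (e0 * e3) = - (e0 * e0) * (e0 * e1 * e2 * e3)"
        by (simp add: algebra_simps)
      hence "(- 1) * (e0 * e1) * (e0 * e2) * (e0 * e3) = 1"
        by (simp add: assms(5) e_square)
      moreover have "{- 1, e0 * e1, e0 * e2, e0 * e3} \<subseteq> pm 1"
        using e by (auto simp: pm_def)
      ultimately have "to_PSL2 P \<in>
          to_PSL2 ` {C ** C, B1 ** (C ** C), B2 ** (C ** C), B1 ** (B2 ** (C ** C))}"
        using klein_coset[OF two d C_C] 1 by simp
      moreover have "to_PSL2 (C ** C) = to_PSL2 C [^]\<^bsub>PSL2\<^esub> (2::nat)"
        by (simp add: numeral_2_eq_2 mult_PSL2)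
      ultimately show ?thesis using coset[of "C ** C" 2] by auto
    qed
  qed
  thus ?thesis unfolding Tet_def by blast
qed

text \<open>A sandwich: the subgroup generated by \<open>S\<close> contains the triple and hence all
  normal forms, while \<open>Tet\<close> and so \<open>S\<close> lie in the subgroup formed by
  them.\<close>

lemma iso_alt_group_4_aux:
  assumes two: "(2 :: 'a) \<noteq> 0" and "det C = 1" and C: "theta (B1, B2) C = (e0, e1, e2, e3)"
    and e: "{e0, e1, e2, e3} \<subseteq> pm 1" and "e0 * e1 * e2 * e3 = - 1"
    and S: "S \<subseteq> carrier PSL2" "S \<subseteq> generate PSL2 Tet"
    and gen: "to_PSL2 B1 \<in> generate PSL2 S" "to_PSL2 B2 \<in> generate PSL2 S"
      "to_PSL2 C \<in> generate PSL2 S"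
  shows "subgroup_generated PSL2 S \<cong> alt_group 4"
proof -
  let ?H = "subgroup_generated (PSL2 :: ('a^2^2) set monoid) S"
  interpret T: tetrahedral_triple PSL2 "to_PSL2 B1" "to_PSL2 B2" "to_PSL2 C"
    using assms(1-5) by (rule tetrahedral_triple_PSL2)
  have carrier: "carrier ?H = generate PSL2 S"
    using S(1) by (simp add: carrier_subgroup_generated Int_absorb1)
  interpret H: tetrahedral_triple ?H "to_PSL2 B1" "to_PSL2 B2" "to_PSL2 C"
    by (rule tetrahedral_triple.intro, rule T.group_subgroup_generated, unfold_locales)
      (use gen T.b1_b1 T.b2_b2 T.b2_b1 T.c_b1 T.c_b2 T.c_cube T.b1_neq_1 in \<open>simp_all add: carrier\<close>)
  have elem: "H.elem x = T.elem x" for x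
    by (simp add: H.elem_def T.elem_def H.klein_def T.klein_def pow_subgroup_generated
        split: prod.split)
  have "generate PSL2 Tet \<subseteq> T.elem ` tet_set"
    using Tet_subset_elem[OF assms(1-5)] T.subgroup_elem by (rule T.generate_subgroup_incl)
  hence "generate PSL2 S \<subseteq> T.elem ` tet_set"
    using S(2) T.subgroup_elem by (intro T.generate_subgroup_incl) auto
  moreover have "T.elem x \<in> generate PSL2 S" for x
    using H.elem_closed[of x] by (simp add: elem carrier)
  ultimately have "carrier ?H = H.elem ` tet_set"
    using elem carrier by auto
  thus ?thesis
    using H.tetrahedral_triple_axioms tetrahedral_iff_iso_alt_group_4[OF H.is_group] by blast
qed

text \<open>Replacing \<open>B2\<close> by \<open>B1 ** B2\<close> flips the sign of the product of the entries of \<open>theta\<close>, on which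
  the direction of the 3-cycle induced by \<open>C\<close> depends.\<close>

lemma swap_pair: "quaternion_pair B1 (B1 ** B2)"
  by unfold_locales
    (simp_all add: det_mul det_B1 det_B2 trace_B1 trace_B2 trace_B1_B2 word_simps)

lemma theta_swap_pair:
  assumes "theta (B1, B2) P = (x0, x1, x2, x3)"
  shows "theta (B1, B1 ** B2) P = (x0, x1, x3, - x2)"
  using assms by (auto simp: theta_def matrix_mul_assoc B1_B1)

lemma Tet_swap_pair: "quaternion_pair.Tet B1 (B1 ** B2) = Tet"
proof -
  have "theta (B1, B1 ** B2) P \<in> Theta4 \<longleftrightarrow> theta (B1, B2) P \<in> Theta4" for P
  proof -
    obtain x0 x1 x2 x3 where x: "theta (B1, B2) P = (x0, x1, x2, x3)"
      by (metis prod_cases4)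
    have "- x2 \<in> pm c \<longleftrightarrow> x2 \<in> pm c" for c
      unfolding pm_def by (metis insert_iff minus_minus singletonD)
    thus ?thesis
      unfolding theta_swap_pair[OF x] x by (auto simp: Theta4_def Theta4_ones_def)
  qed
  thus ?thesis by (simp add: Tet_def quaternion_pair.Tet_def[OF swap_pair])
qed

theorem iso_alt_group_4:
  assumes two: "(2 :: 'a) \<noteq> 0" and "det C = 1" and C: "theta (B1, B2) C \<in> Theta4_ones"
    and S: "S \<subseteq> carrier PSL2" "S \<subseteq> generate PSL2 Tet"
    and gen: "to_PSL2 B1 \<in> generate PSL2 S" "to_PSL2 B2 \<in> generate PSL2 S"
      "to_PSL2 C \<in> generate PSL2 S"
  shows "subgroup_generated PSL2 S \<cong> alt_group 4"
proof -
  obtain e0 e1 e2 e3 where e: "theta (B1, B2) C = (e0, e1, e2, e3)" "{e0, e1, e2, e3} \<subseteq> pm 1"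
    using C by (auto simp: Theta4_ones_def)
  have "e0 * e1 * e2 * e3 = - 1 \<or> e0 * e1 * e2 * e3 = 1"
    using e(2) by (auto simp: pm_def)
  thus ?thesis
  proof
    assume "e0 * e1 * e2 * e3 = - 1"
    thus ?thesis using iso_alt_group_4_aux assms e by blast
  next
    assume 1: "e0 * e1 * e2 * e3 = 1"
    interpret swapped: quaternion_pair B1 "B1 ** B2" by (rule swap_pair)
    show ?thesis
    proof (rule swapped.iso_alt_group_4_aux)
      show "theta (B1, B1 ** B2) C = (e0, e1, e3, - e2)"
        using e(1) by (rule theta_swap_pair)
      show "{e0, e1, e3, - e2} \<subseteq> pm 1" using e(2) by (auto simp: pm_def)
      show "e0 * e1 * e3 * - e2 = - 1" using 1 by (simp add: mult_ac)
      show "S \<subseteq> generate PSL2 swapped.Tet" using S(2) by (simp add: Tet_swap_pair)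
      show "to_PSL2 (B1 ** B2) \<in> generate PSL2 S"
        using generate.eng[OF gen(1,2)] by (simp add: mult_PSL2)
    qed fact+
  qed
qed

end

section \<open>Quaternion pairs made of an element of trace zero and a conjugate of it\<close>

lemma conjugate_quaternion_pair:
  fixes P Q :: "'a::field^2^2"
  assumes "det P = 1" "det Q = 1" "trace P = 0" "trace Q \<in> pm 1" "trace (P ** Q) \<in> pm 1"
  shows "quaternion_pair P (matrix_inv Q ** P ** Q)"
    and "theta (P, matrix_inv Q ** P ** Q) Q \<in> Theta4_ones"
proof -
  let ?y = "trace Q" and ?z = "trace (P ** Q)"
  note inv = matrix_inv_SL2(1-3)[OF assms(2)]
  have yz: "?y * ?y = 1" "?z * ?z = 1" using assms(4,5) by (auto simp: pm_def)
  have cyc: "trace (matrix_inv Q ** P ** Q) = trace P"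
    "trace (matrix_inv Q ** P ** Q ** Q) = ?z"
    using trace_mul_sym[of "matrix_inv Q" "P ** Q"] trace_mul_sym[of "matrix_inv Q" "P ** Q ** Q"]
    by (simp_all add: matrix_mul_assoc[symmetric] inv)
  have PPQ: "trace (P ** P ** Q) = - ?y"
    using trace_square_mult[of P Q] assms by simp
  have PQPQ: "trace (P ** Q ** (P ** Q)) = - 1"
    using trace_square_mult[of "P ** Q" "mat 1"] assms yz by (simp add: det_mul trace_2 mat2_nth)
  \<comment> \<open>The right side is - y^2 - (z^2 - 2) with y, z the traces of \<open>Q\<close> and
    \<open>P ** Q\<close>; it vanishes because y^2 = z^2 = 1.\<close>
  have "trace (matrix_inv Q ** (P ** Q ** P)) = ?y * trace (P ** Q ** P) - trace (Q ** (P ** Q ** P))"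
    by (rule trace_matrix_inv_mult) fact
  moreover have "trace (P ** Q ** P) = - ?y"
    using PPQ trace_mul_sym[of "P ** Q" P] by (simp add: matrix_mul_assoc)
  moreover have "trace (Q ** (P ** Q ** P)) = - 1"
    using PQPQ trace_mul_sym[of Q "P ** Q ** P"] trace_mul_sym[of "P ** Q ** P" Q]
    by (simp add: matrix_mul_assoc)
  ultimately have "trace (matrix_inv Q ** (P ** Q ** P)) = 0"
    using yz by simp
  hence comm: "trace (P ** (matrix_inv Q ** P ** Q)) = 0"
    using trace_mul_sym[of "matrix_inv Q" "P ** Q ** P"]
      trace_mul_sym[of P "matrix_inv Q ** P ** Q"] by (simp add: matrix_mul_assoc)
  show "quaternion_pair P (matrix_inv Q ** P ** Q)"
    by unfold_locales (use assms cyc(1) comm in \<open>simp_all add: det_mul inv(3)\<close>)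
  \<comment> \<open>Bringing Q^2 to the front and expanding it gives y * 0 - (- y), so that
    \<open>theta\<close> of \<open>Q\<close> is (y, z, z, y).\<close>
  have "trace (P ** (matrix_inv Q ** P ** Q) ** Q) = trace (Q ** Q ** (P ** matrix_inv Q ** P))"
    using trace_mul_sym[of "P ** matrix_inv Q ** P" "Q ** Q"] by (simp add: matrix_mul_assoc)
  also have "\<dots> = ?y * trace (Q ** (P ** matrix_inv Q ** P)) - trace (P ** matrix_inv Q ** P)"
    using trace_square_mult[of Q "P ** matrix_inv Q ** P"] assms(2) by simp
  also have "trace (Q ** (P ** matrix_inv Q ** P)) = 0"
    using comm trace_mul_sym[of Q "P ** matrix_inv Q ** P"] by (simp add: matrix_mul_assoc)
  also have "trace (P ** matrix_inv Q ** P) = - ?y"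
    using trace_mul_sym[of "P ** matrix_inv Q" P] trace_square_mult[of P "matrix_inv Q"] assms
    by (simp add: matrix_mul_assoc trace_matrix_inv)
  finally have "trace (P ** (matrix_inv Q ** P ** Q) ** Q) = ?y" by simp
  thus "theta (P, matrix_inv Q ** P ** Q) Q \<in> Theta4_ones"
    using assms(4,5) cyc(2) by (simp add: theta_def Theta4_ones_def)
qed

text \<open>\<open>Q\<close> itself supplies the element of order 3, so \<open>R\<close> may be
  empty. Keeping \<open>a1\<close>, \<open>a2\<close> apart from \<open>P\<close>, \<open>Q\<close>
  allows another generating pair of the same group, as cases (4) and (5) require.\<close>

lemma conjugate_pair_iso_alt_group_4:
  fixes P Q :: "'a::field^2^2"
  assumes two: "(2 :: 'a) \<noteq> 0"
    and PQ: "det P = 1" "det Q = 1" "trace P = 0" "trace Q \<in> pm 1" "trace (P ** Q) \<in> pm 1"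
    and R: "\<And>C. C \<in> R \<Longrightarrow> det C = 1 \<and> theta (P, matrix_inv Q ** P ** Q) C \<in> Theta4"
    and a: "a1 \<in> generate PSL2 {to_PSL2 P, to_PSL2 Q}" "a2 \<in> generate PSL2 {to_PSL2 P, to_PSL2 Q}"
      "to_PSL2 P \<in> generate PSL2 {a1, a2}" "to_PSL2 Q \<in> generate PSL2 {a1, a2}"
  shows "subgroup_generated PSL2 ({a1, a2} \<union> to_PSL2 ` R) \<cong> alt_group 4"
proof -
  let ?B = "matrix_inv Q ** P ** Q" and ?S = "{a1, a2} \<union> to_PSL2 ` R"
  interpret PSL2: group "PSL2 :: ('a^2^2) set monoid" by (rule group_PSL2)
  interpret quaternion_pair P ?B by (rule conjugate_quaternion_pair) fact+
  have ones: "theta (P, ?B) Q \<in> Theta4_ones"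
    using PQ by (rule conjugate_quaternion_pair)
  have pq: "{to_PSL2 P, to_PSL2 Q} \<subseteq> Tet"
    using PQ ones theta_B1 by (auto simp: Tet_def Theta4_def pm_def)
  have S: "to_PSL2 P \<in> generate PSL2 ?S" "to_PSL2 Q \<in> generate PSL2 ?S"
    using a(3,4) PSL2.mono_generate[of "{a1, a2}" ?S] by auto
  have carrier: "{to_PSL2 P, to_PSL2 Q} \<subseteq> carrier PSL2"
    using PQ by (simp add: to_PSL2_in_carrier)
  have S_carrier: "?S \<subseteq> carrier PSL2"
    using a(1,2) PSL2.generate_incl[OF carrier] R by (auto simp: carrier_PSL2)
  show ?thesis
  proof (rule iso_alt_group_4[OF two PQ(2) ones S_carrier])
    have "{a1, a2} \<subseteq> generate PSL2 Tet"
      using a(1,2) PSL2.mono_generate[OF pq] by auto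
    moreover have "to_PSL2 ` R \<subseteq> generate PSL2 Tet"
      using R by (auto simp: Tet_def intro!: generate.incl)
    ultimately show "?S \<subseteq> generate PSL2 Tet" by simp
    have "inv\<^bsub>PSL2\<^esub> to_PSL2 Q \<in> generate PSL2 ?S"
      using PSL2.generate_m_inv_closed[OF S_carrier S(2)] .
    thus "to_PSL2 ?B \<in> generate PSL2 ?S"
      using S by (auto simp: inv_PSL2[OF PQ(2)] intro!: generate.eng simp flip: mult_PSL2)
  qed (use S in auto)
qed

section \<open>The trace criterion for generating A_4\<close>

theorem proposition9p2:
  fixes A :: "nat \<Rightarrow> 'a::{field, finite}^2^2"
    and m :: nat
    and t :: "'a \<times> 'a \<times> 'a"
  assumes "m \<ge> 2"
    and "\<And>i. i \<in> {1..m} \<Longrightarrow> A i \<in> carrier SL2"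
    and "absolutely_irreducible (generate SL2 {A 1, A 2})"
    and "t = (trace (A 1), trace (A 2), trace (A 1 ** A 2))"
  shows "subgroup_generated PSL2 ((\<lambda>i. to_PSL2 (A i)) ` {1..m}) \<cong> alt_group 4 \<longleftrightarrow>
      (t = (0, 0, 0) \<and>
        (\<forall>i\<in>{3..m}. theta (A 1, A 2) (A i) \<in> Theta4) \<and>
        (\<exists>i\<in>{3..m}. theta (A 1, A 2) (A i) \<in> Theta4_ones))
    \<or> (t \<in> {0} \<times> pm 1 \<times> pm 1 \<and>
        (\<forall>i\<in>{3..m}. theta (A 1, matrix_inv (A 2) ** A 1 ** A 2) (A i) \<in> Theta4))
    \<or> (t \<in> pm 1 \<times> {0} \<times> pm 1 \<and>
        (\<forall>i\<in>{3..m}. theta (A 2, matrix_inv (A 1) ** A 2 ** A 1) (A i) \<in> Theta4))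
    \<or> (t \<in> pm 1 \<times> pm 1 \<times> {0} \<and>
        (\<forall>i\<in>{3..m}. theta (A 1 ** A 2, A 2 ** A 1) (A i) \<in> Theta4))
    \<or> (t \<in> {(1, 1, 1), (1, -1, -1), (-1, 1, -1), (-1, -1, 1)} \<and>
        (\<forall>i\<in>{3..m}. theta (A 1 ** matrix_inv (A 2), matrix_inv (A 2) ** A 1) (A i) \<in> Theta4))"
    (is "_ \<longleftrightarrow> ?case1 \<or> ?case2 \<or> ?case3 \<or> ?case4 \<or> ?case5")
proof -
  let ?S = "(\<lambda>i. to_PSL2 (A i)) ` {1..m}"
  let ?H = "subgroup_generated PSL2 ?S"
  let ?A = "A 1" and ?B = "A 2"
  let ?a = "to_PSL2 ?A" and ?b = "to_PSL2 ?B"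
  interpret PSL2: group "PSL2 :: ('a^2^2) set monoid" by (rule group_PSL2)
  have det: "det (A i) = 1" if "i \<in> {1..m}" for i using assms(2)[OF that] by simp
  have dA: "det ?A = 1" and dB: "det ?B = 1" using det assms(1) by simp_all
  \<comment> \<open>Keeps the simplifier from turning \<open>A 1\<close> into
    \<open>A (Suc 0)\<close>.\<close>
  note [simp del] = One_nat_def
  note invB = matrix_inv_SL2(1-3)[OF dB]
  have "{1..m} = {1, 2} \<union> {3..m}" using assms(1) by auto
  hence S: "?S = {?a, ?b} \<union> to_PSL2 ` A ` {3..m}" by (simp add: image_image)
  have S_carrier: "?S \<subseteq> carrier PSL2" using det by (auto simp: carrier_PSL2)
  have carrier: "?a \<in> carrier PSL2" "?b \<in> carrier PSL2" using dA dB by auto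
  have commutator: "det (?A ** ?B - ?B ** ?A) \<noteq> 0"
    using assms(3) dA dB by (rule absolutely_irreducible_commutator)
  \<comment> \<open>For case (5): the trace of A_1 A_2^-1 vanishes exactly when the trace of A_1 A_2
    is the product of the other two.\<close>
  have tr_inv: "trace (?A ** matrix_inv ?B) = trace ?A * trace ?B - trace (?A ** ?B)"
    using trace_matrix_inv_mult[OF dB, of ?A] trace_mul_sym[of ?A] by (simp add: mult.commute)
  show ?thesis
  proof
    assume iso: "?H \<cong> alt_group 4"
    then obtain V where "alt4_klein ?H V"
      using alt4_klein_exists[OF PSL2.group_subgroup_generated] by blast
    then interpret alt4_klein ?H V .
    interpret alt4_klein_PSL2 ?S V by unfold_locales
    have H: "to_PSL2 (A i) \<in> \<Gamma>" if "i \<in> {1..m}" for i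
      using PSL2.subgroup_generated_subset_carrier_subset[OF S_carrier] that by blast
    have a: "?a \<in> \<Gamma>" and b: "?b \<in> \<Gamma>" using H assms(1) by simp_all
    have noncomm: "?A ** ?B \<noteq> ?B ** ?A" using commutator by (auto simp: det_2)
    \<comment> \<open>Matrices equal up to sign commute, and a central matrix commutes with
      everything.\<close>
    have a_1: "?a \<noteq> \<one>\<^bsub>PSL2\<^esub>" and b_1: "?b \<noteq> \<one>\<^bsub>PSL2\<^esub>" and a_b: "?a \<noteq> ?b"
      using noncomm by (auto simp: one_PSL2 to_PSL2_eq_iff)
    have "?a \<noteq> to_PSL2 (matrix_inv ?B)"
      using noncomm invB by (auto simp: to_PSL2_eq_iff)
    hence ab_1: "to_PSL2 (?A ** ?B) \<noteq> \<one>\<^bsub>PSL2\<^esub>"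
      using carrier PSL2.inv_equality[of ?a ?b] PSL2.inv_inv[of ?a]
      by (metis PSL2.inv_equality PSL2.inv_inv inv_PSL2[OF dB] mult_PSL2)
    have ab'_1: "to_PSL2 (?A ** matrix_inv ?B) \<noteq> \<one>\<^bsub>PSL2\<^esub>"
      using a_b carrier PSL2.inv_equality[of ?a "inv\<^bsub>PSL2\<^esub> ?b"] PSL2.inv_inv[of ?b]
      by (metis PSL2.inv_closed inv_PSL2[OF dB] mult_PSL2)
    have all: "\<forall>i\<in>{3..m}. theta (B1, B2) (A i) \<in> Theta4" if "base_pair B1 B2" for B1 B2
      using theta_in_Theta4[OF that] det H by simp
    consider "?a \<in> V" "?b \<in> V" | "?a \<in> V" "?b \<notin> V" | "?a \<notin> V" "?b \<in> V"
      | "?a \<notin> V" "?b \<notin> V" "to_PSL2 (?A ** ?B) \<in> V"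
      | "?a \<notin> V" "?b \<notin> V" "to_PSL2 (?A ** ?B) \<notin> V" "to_PSL2 (?A ** matrix_inv ?B) \<in> V"
      using quotient[OF a b] b by (auto simp: mult_PSL2 inv_PSL2[OF dB])
    thus "?case1 \<or> ?case2 \<or> ?case3 \<or> ?case4 \<or> ?case5"
    proof cases
      case 1
      hence base: "base_pair ?A ?B"
        unfolding base_pair_def using dA dB a_1 b_1 a_b by simp
      then interpret quaternion_pair ?A ?B by (rule base_pair_quaternion)
      \<comment> \<open>The first two generators lie in the proper subgroup \<open>V\<close>, so a
        later one has to leave it.\<close>
      have "\<exists>i\<in>{3..m}. to_PSL2 (A i) \<notin> V"
      proof (rule ccontr)
        assume "\<not> (\<exists>i\<in>{3..m}. to_PSL2 (A i) \<notin> V)"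
        hence "?S \<subseteq> V" unfolding S using 1 by auto
        moreover have "subgroup V PSL2"
          using subgroup_V PSL2.subgroup_subgroup_generated_iff by blast
        ultimately have "\<Gamma> \<subseteq> V" by (intro PSL2.subgroup_generated_minimal)
        thus False using V_proper by simp
      qed
      then obtain i where "i \<in> {3..m}" "to_PSL2 (A i) \<notin> V" by blast
      moreover from this have "theta (?A, ?B) (A i) \<in> Theta4_ones"
        using theta_notin_V[OF base] det H by simp
      ultimately have ?case1
        using all[OF base] trace_B1 trace_B2 trace_B1_B2 assms(4) by blast
      thus ?thesis ..
    next
      case 2
      note conj = conjugate_base_pair[OF dA dB 2(1) a_1 b 2(2)]
      have ?case2 using all[OF conj(1)] conj(2-4) assms(4) by simp
      thus ?thesis by blast
    next
      case 3
      note conj = conjugate_base_pair[OF dB dA 3(2) b_1 a 3(1)]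
      have ?case3 using all[OF conj(1)] conj(2-4) assms(4) trace_mul_sym[of ?A ?B] by simp
      thus ?thesis by blast
    next
      case 4
      have b': "to_PSL2 (matrix_inv ?B) \<in> \<Gamma>" "to_PSL2 (matrix_inv ?B) \<notin> V"
        using inv_closed[OF b] inv_notin_V[OF b 4(2)] b by (simp_all add: inv_PSL2[OF dB])
      have "det (?A ** ?B) = 1" by (simp add: det_mul dA dB)
      \<comment> \<open>Here P = A_1 A_2 and Q = A_2^-1, so the conjugate of P is A_2 A_1 and P Q =
        A_1.\<close>
      note conj = conjugate_base_pair[OF this invB(3) 4(3) ab_1 b']
      have "base_pair (?A ** ?B) (?B ** ?A)"
        using conj(1) by (simp add: matrix_inv_matrix_inv dB invB(2) flip: matrix_mul_assoc)
      moreover have "trace ?A \<in> pm 1" "trace ?B \<in> pm 1" "trace (?A ** ?B) = 0"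
        using conj(2-4) by (simp_all add: trace_matrix_inv dB invB(2) flip: matrix_mul_assoc)
      ultimately have ?case4 using all assms(4) by simp
      thus ?thesis by blast
    next
      case 5
      have "det (?A ** matrix_inv ?B) = 1" by (simp add: det_mul dA invB(3))
      \<comment> \<open>Here P = A_1 A_2^-1 and Q = A_2, so the conjugate of P is A_2^-1 A_1 and P Q
        = A_1.\<close>
      note conj = conjugate_base_pair[OF this dB 5(4) ab'_1 b 5(2)]
      have base: "base_pair (?A ** matrix_inv ?B) (matrix_inv ?B ** ?A)"
        using conj(1) by (simp add: invB(1) flip: matrix_mul_assoc)
      have "to_PSL2 (?A ** ?B) \<in> \<Gamma>"
        using m_closed[OF a b] by (simp add: mult_PSL2)
      hence z: "trace (?A ** ?B) \<in> pm 1"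
        using 5 by (intro trace_notin_V) (simp_all add: det_mul dA dB)
      \<comment> \<open>The product relation is \<open>tr_inv\<close> with left side 0; for signs it
        says that the number of -1's is even.\<close>
      have xy: "trace ?A \<in> pm 1" "trace ?B \<in> pm 1" "trace ?A * trace ?B = trace (?A ** ?B)"
        using conj(2-4) tr_inv by (simp_all add: invB(1) flip: matrix_mul_assoc)
      have "t \<in> {(1, 1, 1), (1, -1, -1), (-1, 1, -1), (-1, -1, 1)}"
        unfolding assms(4) xy(3)[symmetric] using xy(1,2) by (auto simp: pm_def)
      hence ?case5 using all[OF base] by blast
      thus ?thesis by blast
    qed
  next
    assume cases: "?case1 \<or> ?case2 \<or> ?case3 \<or> ?case4 \<or> ?case5"
    have two: "(2 :: 'a) \<noteq> 0"
    proof
      assume "(2 :: 'a) = 0"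
      \<comment> \<open>The commutator determinant is 4 in case (1) and 2 in the others, hence would
        vanish.\<close>
      moreover have "(4 :: 'a) = 2 * 2" by simp
      ultimately have "(4 :: 'a) = 0" "(1 :: 'a) + 1 = 0" by simp_all
      thus False
        using cases commutator assms(4) unfolding det_commutator dA dB by (auto simp: pm_def)
    qed
    have gen: "?a \<in> generate PSL2 {?a, ?b}" "?b \<in> generate PSL2 {?a, ?b}"
      by (auto intro: generate.incl)
    have R: "det C = 1 \<and> theta B C \<in> Theta4"
      if "\<forall>i\<in>{3..m}. theta B (A i) \<in> Theta4" "C \<in> A ` {3..m}" for B C
      using that det by auto
    note inv_b = inv_PSL2[OF dB]
    show "?H \<cong> alt_group 4"
      using cases
    proof (elim disjE)
      assume 1: ?case1
      \<comment> \<open>This generator plays the part of the element of order 3, as A_1 and A_2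
        yield only the Klein subgroup.\<close>
      then obtain i where i: "i \<in> {3..m}" "theta (?A, ?B) (A i) \<in> Theta4_ones" by blast
      interpret quaternion_pair ?A ?B
        by unfold_locales (use 1 assms(4) dA dB in simp_all)
      show ?thesis
      proof (rule iso_alt_group_4[OF two _ i(2) S_carrier])
        have "?a \<in> Tet" "?b \<in> Tet"
          using dA dB theta_B1 theta_B2 by (auto simp: Tet_def Theta4_def pm_def)
        moreover have "to_PSL2 ` A ` {3..m} \<subseteq> Tet"
          using 1 det by (auto simp: Tet_def)
        ultimately have "?S \<subseteq> Tet" unfolding S by simp
        thus "?S \<subseteq> generate PSL2 Tet" by (auto intro: generate.incl)
        show "?a \<in> generate PSL2 ?S" "?b \<in> generate PSL2 ?S" "to_PSL2 (A i) \<in> generate PSL2 ?S"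
          using i(1) assms(1) by (auto intro!: generate.incl imageI)
      qed (use i det in simp)
    next
      assume 2: ?case2
      show ?thesis unfolding S
        using 2 assms(4)
        by (intro conjugate_pair_iso_alt_group_4[OF two dA dB]) (use gen R in auto)
    next
      assume 3: ?case3
      show ?thesis unfolding S
        using 3 assms(4) trace_mul_sym[of ?A ?B]
        by (intro conjugate_pair_iso_alt_group_4[OF two dB dA])
          (use gen R in \<open>auto simp: insert_commute\<close>)
    next
      assume 4: ?case4
      let ?P = "?A ** ?B" and ?Q = "matrix_inv ?B"
      have conj: "matrix_inv ?Q ** ?P ** ?Q = ?B ** ?A"
        by (simp add: matrix_inv_matrix_inv dB invB(2) flip: matrix_mul_assoc)
      \<comment> \<open>The traces of \<open>?Q\<close> and \<open>?P ** ?Q\<close> are thus those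
        of A_2 and A_1.\<close>
      have PQ: "?P ** ?Q = ?A" by (simp add: invB(2) flip: matrix_mul_assoc)
      show ?thesis unfolding S
      proof (rule conjugate_pair_iso_alt_group_4[OF two, of ?P ?Q])
        show "det C = 1 \<and> theta (?P, matrix_inv ?Q ** ?P ** ?Q) C \<in> Theta4"
          if "C \<in> A ` {3..m}" for C
          unfolding conj using 4 that by (intro R) auto
        have p: "to_PSL2 ?P \<in> generate PSL2 {to_PSL2 ?P, to_PSL2 ?Q}"
          and q: "to_PSL2 ?Q \<in> generate PSL2 {to_PSL2 ?P, to_PSL2 ?Q}"
          by (auto intro: generate.incl)
        show "?a \<in> generate PSL2 {to_PSL2 ?P, to_PSL2 ?Q}"
          using generate.eng[OF p q] by (simp add: mult_PSL2 PQ)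
        show "?b \<in> generate PSL2 {to_PSL2 ?P, to_PSL2 ?Q}"
          using generate.inv[of "to_PSL2 ?Q" "{to_PSL2 ?P, to_PSL2 ?Q}" PSL2]
          by (simp add: inv_PSL2[OF invB(3)] matrix_inv_matrix_inv dB)
        show "to_PSL2 ?P \<in> generate PSL2 {?a, ?b}"
          using generate.eng[OF gen] by (simp add: mult_PSL2)
        show "to_PSL2 ?Q \<in> generate PSL2 {?a, ?b}"
          using generate.inv[of ?b "{?a, ?b}" PSL2] by (simp add: inv_b)
      qed (use 4 assms(4) dA dB invB(3) in \<open>simp_all add: det_mul trace_matrix_inv PQ\<close>)
    next
      assume 5: ?case5
      let ?P = "?A ** matrix_inv ?B"
      have conj: "matrix_inv ?B ** ?P ** ?B = matrix_inv ?B ** ?A"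
        by (simp add: invB(1) flip: matrix_mul_assoc)
      have PQ: "?P ** ?B = ?A" by (simp add: invB(1) flip: matrix_mul_assoc)
      \<comment> \<open>Each listed triple satisfies z = x y, which makes the trace of
        \<open>?P\<close> zero by \<open>tr_inv\<close>.\<close>
      have xyz: "trace ?A \<in> pm 1" "trace ?B \<in> pm 1" "trace ?P = 0"
        unfolding tr_inv using 5 assms(4) by (auto simp: pm_def)
      show ?thesis unfolding S
      proof (rule conjugate_pair_iso_alt_group_4[OF two, of ?P ?B])
        show "det C = 1 \<and> theta (?P, matrix_inv ?B ** ?P ** ?B) C \<in> Theta4"
          if "C \<in> A ` {3..m}" for C
          unfolding conj using 5 that by (intro R) auto
        have p: "to_PSL2 ?P \<in> generate PSL2 {to_PSL2 ?P, ?b}"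
          and q: "?b \<in> generate PSL2 {to_PSL2 ?P, ?b}"
          by (auto intro: generate.incl)
        show "?a \<in> generate PSL2 {to_PSL2 ?P, ?b}"
          using generate.eng[OF p q] by (simp add: mult_PSL2 PQ)
        show "?b \<in> generate PSL2 {to_PSL2 ?P, ?b}" by (rule q)
        have "to_PSL2 (matrix_inv ?B) \<in> generate PSL2 {?a, ?b}"
          using generate.inv[of ?b "{?a, ?b}" PSL2] by (simp add: inv_b)
        thus "to_PSL2 ?P \<in> generate PSL2 {?a, ?b}"
          using generate.eng[OF gen(1)] by (metis mult_PSL2)
        show "?b \<in> generate PSL2 {?a, ?b}" by (rule gen(2))
      qed (use xyz dA dB invB(3) in \<open>simp_all add: det_mul PQ\<close>)
    qed
  qed
qed

end
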